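(* Every binary pattern $P$ that contains none of $Q_1,Q_2,Q_3,Q_4$ as an interval minor is row-bounding, i.e., $\mathrm{Av}(P)$ is row-bounded. Here $Q_1,\dots,Q_4\in\{0,1\}^{3\times3}$ have supports $\{(1,2),(2,1),(3,3)\}$, $\{(1,2),(2,3),(3,1)\}$, $\{(1,1),(2,3),(3,2)\}$, $\{(1,3),(2,1),(3,2)\}$ respectively.
   Context: All matrices are binary; rows are numbered top to bottom, columns left to right; $(i,j)$ is the entry in row $i$, column $j$, a 1-entry if it equals 1; $\mathrm{supp}$ is the set of 1-entries. For integers, $(a,b]=\{a+1,\dots,b\}$. A pattern $P\in\{0,1\}^{k\times\ell}$ is an interval minor of $M\in\{0,1\}^{m\times n}$ if there are integers $0=r_0<\dots<r_k=m$ and $0=c_0<\dots<c_\ell=n$ such that for each 1-entry $(i,j)$ of $P$ the submatrix of $M$ on rows $(r_{i-1},r_i]$ and columns $(c_{j-1},c_j]$ contains a 1-entry; otherwise $M$ avoids $P$. $\mathrm{Av}(P)$ is the set of binary matrices avoiding $P$. A matrix $M\in\mathcal C$ is critical for $\mathcal C$ if changing any single 0-entry of $M$ into a 1-entry gives a matrix outside $\mathcal C$. A horizontal 0-run is a maximal set of consecutive 0-entries within a single row; the complexity of a row is the number of horizontal 0-runs in it. The row-complexity of $\mathcal C$ is the supremum over matrices critical for $\mathcal C$ of the maximum complexity of a row; $\mathcal C$ is row-bounded if it is finite. *)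

theory Defs
  imports Main
begin

text \<open>A binary matrix with m rows and n columns is represented by its dimensions
  together with a function A :: nat => nat => bool; the entry in row i, column j
  (1 <= i <= m, 1 <= j <= n) is A i j (True = 1-entry). Values outside the range
  are irrelevant.\<close>

definition interval_minor ::
  "nat \<Rightarrow> nat \<Rightarrow> (nat \<Rightarrow> nat \<Rightarrow> bool) \<Rightarrow> nat \<Rightarrow> nat \<Rightarrow> (nat \<Rightarrow> nat \<Rightarrow> bool) \<Rightarrow> bool" where
  "interval_minor k l P m n M \<longleftrightarrow>
     (\<exists>r c :: nat \<Rightarrow> nat.
        r 0 = 0 \<and> r k = m \<and> (\<forall>i<k. r i < r (Suc i)) \<and>
        c 0 = 0 \<and> c l = n \<and> (\<forall>j<l. c j < c (Suc j)) \<and>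
        (\<forall>i\<in>{1..k}. \<forall>j\<in>{1..l}. P i j \<longrightarrow>
           (\<exists>a\<in>{r (i - 1)<..r i}. \<exists>b\<in>{c (j - 1)<..c j}. M a b)))"

definition avoids ::
  "nat \<Rightarrow> nat \<Rightarrow> (nat \<Rightarrow> nat \<Rightarrow> bool) \<Rightarrow> nat \<Rightarrow> nat \<Rightarrow> (nat \<Rightarrow> nat \<Rightarrow> bool) \<Rightarrow> bool" where
  "avoids k l P m n M \<longleftrightarrow> \<not> interval_minor k l P m n M"

definition set_one :: "(nat \<Rightarrow> nat \<Rightarrow> bool) \<Rightarrow> nat \<Rightarrow> nat \<Rightarrow> nat \<Rightarrow> nat \<Rightarrow> bool" where
  "set_one M i j = (\<lambda>a b. if a = i \<and> b = j then True else M a b)"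

definition critical_Av ::
  "nat \<Rightarrow> nat \<Rightarrow> (nat \<Rightarrow> nat \<Rightarrow> bool) \<Rightarrow> nat \<Rightarrow> nat \<Rightarrow> (nat \<Rightarrow> nat \<Rightarrow> bool) \<Rightarrow> bool" where
  "critical_Av k l P m n M \<longleftrightarrow>
     avoids k l P m n M \<and>
     (\<forall>i\<in>{1..m}. \<forall>j\<in>{1..n}. \<not> M i j \<longrightarrow> \<not> avoids k l P m n (set_one M i j))"

definition zero_block :: "nat \<Rightarrow> (nat \<Rightarrow> nat \<Rightarrow> bool) \<Rightarrow> nat \<Rightarrow> nat set \<Rightarrow> bool" where
  "zero_block n M i S \<longleftrightarrow> (\<exists>a b. a \<le> b \<and> S = {a..b}) \<and> S \<subseteq> {1..n} \<and> (\<forall>j\<in>S. \<not> M i j)"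

definition zero_runs :: "nat \<Rightarrow> (nat \<Rightarrow> nat \<Rightarrow> bool) \<Rightarrow> nat \<Rightarrow> nat set set" where
  "zero_runs n M i = {S. zero_block n M i S \<and> (\<forall>T. zero_block n M i T \<and> S \<subseteq> T \<longrightarrow> T = S)}"

definition row_complexity :: "nat \<Rightarrow> (nat \<Rightarrow> nat \<Rightarrow> bool) \<Rightarrow> nat \<Rightarrow> nat" where
  "row_complexity n M i = card (zero_runs n M i)"

definition row_bounding :: "nat \<Rightarrow> nat \<Rightarrow> (nat \<Rightarrow> nat \<Rightarrow> bool) \<Rightarrow> bool" where
  "row_bounding k l P \<longleftrightarrow>
     (\<exists>B::nat. \<forall>m n M. critical_Av k l P m n M \<longrightarrow>
        (\<forall>i\<in>{1..m}. row_complexity n M i \<le> B))"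

definition Q1 :: "nat \<Rightarrow> nat \<Rightarrow> bool" where
  "Q1 i j \<longleftrightarrow> (i, j) \<in> {(1,2),(2,1),(3,3)}"
definition Q2 :: "nat \<Rightarrow> nat \<Rightarrow> bool" where
  "Q2 i j \<longleftrightarrow> (i, j) \<in> {(1,2),(2,3),(3,1)}"
definition Q3 :: "nat \<Rightarrow> nat \<Rightarrow> bool" where
  "Q3 i j \<longleftrightarrow> (i, j) \<in> {(1,1),(2,3),(3,2)}"
definition Q4 :: "nat \<Rightarrow> nat \<Rightarrow> bool" where
  "Q4 i j \<longleftrightarrow> (i, j) \<in> {(1,3),(2,1),(3,2)}"

end

theory Submission
  imports Defs "HOL-Library.Ramsey"
begin

text \<open>Avoiding the four patterns means that any three 1-entries of P in distinct rows and columns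
  form an increasing or a decreasing chain. If a row i of a critical matrix M has many 0-runs, then
  by pigeonhole the new 1-entry plays the role of one and the same 1-entry (p, q) of P for many
  0-entries of row i, any two of them separated by a 1-entry of row i. Gluing the columns left of q
  of one such gridding, the columns right of q of a later one, and row blocks chosen from
  both, with the intermediate 1-entries of row i serving row p of P, yields P inside M. Which row
  blocks to take depends on the quadrants around (p, q) that contain 1-entries of P. Gluing two
  griddings does not suffice for a pattern with only two nonempty rows; there Ramsey's
  theorem first makes the row boundary monotone along the griddings.\<close>

section \<open>Griddings and flips\<close>

text \<open>Columns glue without conflict: block q of a gridding holds no 1-entry of row i, so the
  separators in row i between two griddings lie right of block q of the earlier one and left of
  block q of the later one. The obstacle is the rows. A glued row block can serve a 1-entry of P
  only if it contains the matching block of the gridding that supplies this entry, and two griddings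
  may cut the rows differently. Monotone triples limit the damage: compared with (p, q), 1-entries
  in horizontally adjacent quadrants share their row, so at most two rows u and v must accommodate
  both griddings, and their blocks can be stretched to contain both originals. If P has just the
  rows u and p, the triple condition is void, the 1-entries of the two rows may interleave, and the
  conflicting boundary between these rows cannot be stretched in both directions; the columns left
  of q are then embedded one at a time, at the price of many griddings.\<close>

definition grid :: "nat \<Rightarrow> nat \<Rightarrow> (nat \<Rightarrow> nat) \<Rightarrow> bool" where
  "grid k m r \<longleftrightarrow> r 0 = 0 \<and> r k = m \<and> (\<forall>i<k. r i < r (Suc i))"

definition hit :: "(nat \<Rightarrow> nat \<Rightarrow> bool) \<Rightarrow> (nat \<Rightarrow> nat) \<Rightarrow> (nat \<Rightarrow> nat) \<Rightarrow> nat \<Rightarrow> nat \<Rightarrow> bool" where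
  "hit M r c a b \<longleftrightarrow> (\<exists>x\<in>{r (a - 1)<..r a}. \<exists>y\<in>{c (b - 1)<..c b}. M x y)"

definition ones :: "nat \<Rightarrow> nat \<Rightarrow> (nat \<Rightarrow> nat \<Rightarrow> bool) \<Rightarrow> (nat \<times> nat) set" where
  "ones k l P = {(a, b). a \<in> {1..k} \<and> b \<in> {1..l} \<and> P a b}"

lemma interval_minor_iff:
  "interval_minor k l P m n M \<longleftrightarrow>
    (\<exists>r c. grid k m r \<and> grid l n c \<and> (\<forall>(a, b)\<in>ones k l P. hit M r c a b))"
proof -
  have "(\<forall>(a, b)\<in>ones k l P. hit M r c a b) \<longleftrightarrow>
    (\<forall>i\<in>{1..k}. \<forall>j\<in>{1..l}. P i j \<longrightarrow>
      (\<exists>a\<in>{r (i - 1)<..r i}. \<exists>b\<in>{c (j - 1)<..c j}. M a b))" for r c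
    unfolding ones_def hit_def by blast
  then show ?thesis unfolding interval_minor_def grid_def by (simp add: conj_assoc)
qed

lemma onesD:
  assumes "(a, b) \<in> ones k l P"
  shows "1 \<le> a" "a \<le> k" "1 \<le> b" "b \<le> l" "P a b"
  using assms by (auto simp: ones_def)

lemma grid_less: "grid k m r \<Longrightarrow> a < b \<Longrightarrow> b \<le> k \<Longrightarrow> r a < r b"
proof (induction b)
  case (Suc b)
  then have "r b < r (Suc b)" by (simp add: grid_def)
  with Suc show ?case by (cases "a = b") auto
qed simp

lemma grid_mono: "grid k m r \<Longrightarrow> a \<le> b \<Longrightarrow> b \<le> k \<Longrightarrow> r a \<le> r b"
  using grid_less[of k m r a b] by (cases "a = b") auto

lemma grid_ge: "grid k m r \<Longrightarrow> a \<le> k \<Longrightarrow> a \<le> r a"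
proof (induction a)
  case (Suc a)
  then have "r a < r (Suc a)" by (simp add: grid_def)
  with Suc show ?case by auto
qed simp

text \<open>Each of the k - a later blocks takes at least one row. Together with
  \<open>grid_ge\<close> this tells how far a boundary can be pushed outwards.\<close>

lemma grid_le_minus: "grid k m r \<Longrightarrow> a \<le> k \<Longrightarrow> r a + (k - a) \<le> m"
proof (induction "k - a" arbitrary: a)
  case 0
  then show ?case by (simp add: grid_def)
next
  case (Suc d)
  then have "r a < r (Suc a)" "r (Suc a) + (k - Suc a) \<le> m"
    by (simp_all add: grid_def)
  with Suc show ?case by linarith
qed

lemma grid_bound: "grid k m r \<Longrightarrow> a \<le> k \<Longrightarrow> r a \<le> m"
  using grid_le_minus by fastforce

lemma gridI:
  assumes "r 0 = 0" "r k = m" "\<And>a. a < k \<Longrightarrow> r a < r (Suc a)"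
  shows "grid k m r"
  using assms by (simp add: grid_def)

text \<open>The boundaries of the gridding reflected by x to m + 1 - x. Blocks are open at their
  start, so a boundary value v is sent to m - v and not to m + 1 - v.\<close>

definition flip_grid :: "nat \<Rightarrow> nat \<Rightarrow> (nat \<Rightarrow> nat) \<Rightarrow> nat \<Rightarrow> nat" where
  "flip_grid k m r a = m - r (k - a)"

lemma grid_flip:
  assumes "grid k m r"
  shows "grid k m (flip_grid k m r)"
proof (rule gridI)
  fix a assume a: "a < k"
  then have "r (k - Suc a) < r (k - a)" using grid_less[OF assms] by simp
  moreover have "r (k - a) \<le> m" using grid_bound[OF assms] by simp
  ultimately show "flip_grid k m r a < flip_grid k m r (Suc a)" by (simp add: flip_grid_def)
qed (use assms in \<open>auto simp: flip_grid_def grid_def\<close>)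

lemma window_flip:
  assumes r: "grid k m r" and a: "1 \<le> a" "a \<le> k" and x: "1 \<le> x" "x \<le> m"
  shows "m + 1 - x \<in> {flip_grid k m r (k + 1 - a - 1)<..flip_grid k m r (k + 1 - a)} \<longleftrightarrow>
    x \<in> {r (a - 1)<..r a}"
proof -
  have "r (a - 1) \<le> m" "r a \<le> m" using grid_bound[OF r] a by auto
  moreover have "k - (k + 1 - a) = a - 1" "k - (k + 1 - a - 1) = a" using a by auto
  ultimately show ?thesis using x by (auto simp: flip_grid_def)
qed

lemma window_in_range:
  assumes "grid k m r" "1 \<le> a" "a \<le> k" "x \<in> {r (a - 1)<..r a}"
  shows "1 \<le> x" "x \<le> m"
  using assms grid_bound[OF assms(1), of a] by auto

definition flip_cols :: "nat \<Rightarrow> (nat \<Rightarrow> nat \<Rightarrow> bool) \<Rightarrow> nat \<Rightarrow> nat \<Rightarrow> bool" where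
  "flip_cols n M a b = M a (n + 1 - b)"

definition flip_rows :: "nat \<Rightarrow> (nat \<Rightarrow> nat \<Rightarrow> bool) \<Rightarrow> nat \<Rightarrow> nat \<Rightarrow> bool" where
  "flip_rows m M a b = M (m + 1 - a) b"

lemma ones_flip_cols:
  "(a, b) \<in> ones k l (flip_cols l P) \<longleftrightarrow> b \<in> {1..l} \<and> (a, l + 1 - b) \<in> ones k l P"
  by (auto simp: ones_def flip_cols_def)

lemma ones_flip_rows:
  "(a, b) \<in> ones k l (flip_rows k P) \<longleftrightarrow> a \<in> {1..k} \<and> (k + 1 - a, b) \<in> ones k l P"
  by (auto simp: ones_def flip_rows_def)

lemma hit_flip_cols:
  assumes c: "grid l n c" and b: "1 \<le> b" "b \<le> l" and h: "hit M r c a (l + 1 - b)"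
  shows "hit (flip_cols n M) r (flip_grid l n c) a b"
proof -
  define b' where "b' = l + 1 - b"
  have b': "1 \<le> b'" "b' \<le> l" "l + 1 - b' = b" using b by (auto simp: b'_def)
  obtain x y where x: "x \<in> {r (a - 1)<..r a}" and y: "y \<in> {c (b' - 1)<..c b'}" and "M x y"
    using h by (auto simp: hit_def b'_def)
  moreover have yr: "1 \<le> y" "y \<le> n" using window_in_range[OF c b'(1,2) y] by auto
  ultimately have "flip_cols n M x (n + 1 - y)" by (simp add: flip_cols_def)
  moreover have "n + 1 - y \<in> {flip_grid l n c (b - 1)<..flip_grid l n c b}"
    using window_flip[OF c b'(1,2) yr] y b'(3) by metis
  ultimately show ?thesis using x unfolding hit_def by blast
qed

lemma hit_flip_rows:
  assumes r: "grid k m r" and a: "1 \<le> a" "a \<le> k" and h: "hit M r c (k + 1 - a) b"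
  shows "hit (flip_rows m M) (flip_grid k m r) c a b"
proof -
  define a' where "a' = k + 1 - a"
  have a': "1 \<le> a'" "a' \<le> k" "k + 1 - a' = a" using a by (auto simp: a'_def)
  obtain x y where x: "x \<in> {r (a' - 1)<..r a'}" and y: "y \<in> {c (b - 1)<..c b}" and "M x y"
    using h by (auto simp: hit_def a'_def)
  moreover have xr: "1 \<le> x" "x \<le> m" using window_in_range[OF r a'(1,2) x] by auto
  ultimately have "flip_rows m M (m + 1 - x) y" by (simp add: flip_rows_def)
  moreover have "m + 1 - x \<in> {flip_grid k m r (a - 1)<..flip_grid k m r a}"
    using window_flip[OF r a'(1,2) xr] x a'(3) by metis
  ultimately show ?thesis using y unfolding hit_def by blast
qed

lemma hit_mono:
  assumes "hit M r c a b"
    and "{r (a - 1)<..r a} \<subseteq> {r' (a' - 1)<..r' a'}" "{c (b - 1)<..c b} \<subseteq> {c' (b' - 1)<..c' b'}"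
  shows "hit M r' c' a' b'"
  using assms unfolding hit_def by blast

text \<open>Flipping a matrix twice restores it on the indices in range, but truncated subtraction
  spoils it far outside; hence the comparison restricted to the range.\<close>

lemma hit_cong:
  assumes "grid k m r" "1 \<le> a" "a \<le> k" "grid l n c" "1 \<le> b" "b \<le> l"
    and "\<And>x y. x \<in> {1..m} \<Longrightarrow> y \<in> {1..n} \<Longrightarrow> M x y = M' x y" "hit M r c a b"
  shows "hit M' r c a b"
  using assms window_in_range[of k m r a] window_in_range[of l n c b]
  unfolding hit_def by (metis atLeastAtMost_iff)

lemma interval_minor_flip_cols:
  assumes "interval_minor k l (flip_cols l P) m n (flip_cols n M)"
  shows "interval_minor k l P m n M"
proof -
  obtain r c where r: "grid k m r" and c: "grid l n c"
    and h: "\<forall>(a, b)\<in>ones k l (flip_cols l P). hit (flip_cols n M) r c a b"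
    using assms unfolding interval_minor_iff by blast
  have "hit M r (flip_grid l n c) a b" if ab: "(a, b) \<in> ones k l P" for a b
  proof -
    have b: "1 \<le> a" "a \<le> k" "1 \<le> b" "b \<le> l" using onesD[OF ab] by auto
    then have "(a, l + 1 - b) \<in> ones k l (flip_cols l P)"
      using ab by (auto simp: ones_flip_cols)
    then have "hit (flip_cols n M) r c a (l + 1 - b)" using h by blast
    then have "hit (flip_cols n (flip_cols n M)) r (flip_grid l n c) a b"
      by (rule hit_flip_cols[OF c b(3,4)])
    then show ?thesis
      by (rule hit_cong[OF r b(1,2) grid_flip[OF c] b(3,4), rotated]) (auto simp: flip_cols_def)
  qed
  then show ?thesis using r grid_flip[OF c] unfolding interval_minor_iff by blast
qed

lemma interval_minor_flip_rows:
  assumes "interval_minor k l (flip_rows k P) m n (flip_rows m M)"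
  shows "interval_minor k l P m n M"
proof -
  obtain r c where r: "grid k m r" and c: "grid l n c"
    and h: "\<forall>(a, b)\<in>ones k l (flip_rows k P). hit (flip_rows m M) r c a b"
    using assms unfolding interval_minor_iff by blast
  have "hit M (flip_grid k m r) c a b" if ab: "(a, b) \<in> ones k l P" for a b
  proof -
    have a: "1 \<le> a" "a \<le> k" "1 \<le> b" "b \<le> l" using onesD[OF ab] by auto
    then have "(k + 1 - a, b) \<in> ones k l (flip_rows k P)"
      using ab by (auto simp: ones_flip_rows)
    then have "hit (flip_rows m M) r c (k + 1 - a) b" using h by blast
    then have "hit (flip_rows m (flip_rows m M)) (flip_grid k m r) c a b"
      by (rule hit_flip_rows[OF r a(1,2)])
    then show ?thesis
      by (rule hit_cong[OF grid_flip[OF r] a(1,2) c a(3,4), rotated]) (auto simp: flip_rows_def)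
  qed
  then show ?thesis using c grid_flip[OF r] unfolding interval_minor_iff by blast
qed

section \<open>Families of griddings\<close>

text \<open>Each column e in E indexes a gridding of the matrix obtained from M by
  turning the 0-entry (i, e) into a 1-entry; the new entry plays the role of the 1-entry (p, q)
  of P.\<close>

locale family =
  fixes k l :: nat and P :: "nat \<Rightarrow> nat \<Rightarrow> bool" and m n :: nat and M :: "nat \<Rightarrow> nat \<Rightarrow> bool"
    and p q i :: nat and E :: "nat set" and r c :: "nat \<Rightarrow> nat \<Rightarrow> nat"
  assumes no_minor: "\<not> interval_minor k l P m n M"
    and pq: "(p, q) \<in> ones k l P"
    and E_range: "E \<subseteq> {1..n}"
    and grid_r: "e \<in> E \<Longrightarrow> grid k m (r e)"
    and grid_c: "e \<in> E \<Longrightarrow> grid l n (c e)"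
    and row_i: "e \<in> E \<Longrightarrow> i \<in> {r e (p - 1)<..r e p}"
    and col_e: "e \<in> E \<Longrightarrow> e \<in> {c e (q - 1)<..c e q}"
    and hits: "e \<in> E \<Longrightarrow> (a, b) \<in> ones k l P \<Longrightarrow> (a, b) \<noteq> (p, q) \<Longrightarrow> hit M (r e) (c e) a b"
    and separated: "e \<in> E \<Longrightarrow> e' \<in> E \<Longrightarrow> e < e' \<Longrightarrow> \<exists>f. e < f \<and> f < e' \<and> M i f"
begin

lemma family_subset: "E' \<subseteq> E \<Longrightarrow> family k l P m n M p q i E' r c"
  by unfold_locales
    (use no_minor pq E_range grid_r grid_c row_i col_e hits separated in \<open>simp_all add: subset_iff\<close>)

lemma finite_E: "finite E"
  using E_range finite_subset by blast

lemma pq_range: "1 \<le> p" "p \<le> k" "1 \<le> q" "q \<le> l"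
  using onesD[OF pq] by auto

lemma minorI:
  assumes "grid k m R" "grid l n C" "\<And>a b. (a, b) \<in> ones k l P \<Longrightarrow> hit M R C a b"
  shows False
  using assms no_minor unfolding interval_minor_iff by blast

text \<open>Otherwise f could replace e in the gridding at e.\<close>

lemma one_outside_block:
  assumes "e \<in> E" "M i f"
  shows "f \<notin> {c e (q - 1)<..c e q}"
proof
  assume "f \<in> {c e (q - 1)<..c e q}"
  then have "hit M (r e) (c e) p q" using assms row_i unfolding hit_def by blast
  then have "hit M (r e) (c e) a b" if "(a, b) \<in> ones k l P" for a b
    using hits[OF assms(1) that] by (cases "(a, b) = (p, q)") auto
  then show False using minorI[OF grid_r grid_c] assms by blast
qed

lemma one_after: "e \<in> E \<Longrightarrow> M i f \<Longrightarrow> e < f \<Longrightarrow> c e q < f"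
  using one_outside_block[of e f] col_e[of e] by auto

lemma one_before: "e \<in> E \<Longrightarrow> M i f \<Longrightarrow> f < e \<Longrightarrow> f \<le> c e (q - 1)"
  using one_outside_block[of e f] col_e[of e] by auto

text \<open>Every gap between consecutive elements of \<open>E'\<close> holds a 1-entry of row i.
  The induction removes the maximum and appends a separator of the last gap.\<close>

lemma many_separators:
  assumes "E' \<subseteq> E" "card E' = Suc N"
  shows "\<exists>F. (\<forall>j<N. Min E' < F j \<and> F j < Max E' \<and> M i (F j)) \<and> (\<forall>j. Suc j < N \<longrightarrow> F j < F (Suc j))"
  using assms
proof (induction N arbitrary: E')
  case 0
  then show ?case by simp
next
  case (Suc N)
  define t where "t = Max E'"
  define E'' where "E'' = E' - {t}"
  have fin: "finite E'" using Suc.prems(1) finite_E finite_subset by blast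
  have "E' \<noteq> {}" using Suc.prems by auto
  then have t: "t \<in> E'" using fin by (simp add: t_def)
  have card: "card E'' = Suc N" using t fin Suc.prems by (simp add: E''_def)
  have ne: "E'' \<noteq> {}" using card by auto
  have fin2: "finite E''" using fin by (simp add: E''_def)
  obtain F where F: "\<forall>j<N. Min E'' < F j \<and> F j < Max E'' \<and> M i (F j)"
    "\<forall>j. Suc j < N \<longrightarrow> F j < F (Suc j)"
    using Suc.IH[OF _ card] Suc.prems by (auto simp: E''_def)
  define t' where "t' = Max E''"
  have t': "t' \<in> E''" using ne fin2 by (simp add: t'_def)
  have "t' < t" using t' fin unfolding E''_def t_def
    by (metis Diff_iff Max_ge le_neq_implies_less singletonI)
  then obtain f where f: "t' < f" "f < t" "M i f"
    using separated t t' Suc.prems by (metis Diff_iff E''_def subsetD)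
  have mins: "Min E' \<le> Min E''" using ne fin by (simp add: E''_def Min_antimono)
  have mt: "Min E'' \<le> t'" using t' fin2 by simp
  define G where "G = (\<lambda>j. if j < N then F j else f)"
  have "Min E' < G j \<and> G j < Max E' \<and> M i (G j)" if "j < Suc N" for j
  proof (cases "j < N")
    case True
    then have "Min E'' < F j" "F j < t'" "M i (F j)" using F t'_def by auto
    then show ?thesis using True mins \<open>t' < t\<close> unfolding G_def t_def by simp
  next
    case False
    then show ?thesis using f mins mt unfolding G_def t_def by simp
  qed
  moreover have "G j < G (Suc j)" if "Suc j < Suc N" for j
  proof (cases "Suc j < N")
    case True
    then show ?thesis using F by (simp add: G_def)
  next
    case False
    then have "j < N" "\<not> Suc j < N" using that by auto
    then have "F j < t'" using F t'_def by auto
    then show ?thesis using \<open>j < N\<close> \<open>\<not> Suc j < N\<close> f by (simp add: G_def)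
  qed
  ultimately show ?case by blast
qed

text \<open>Columns before b0 come from the leftmost gridding, columns from b1 on from the
  rightmost one, and each column block in between contains a 1-entry of row i.\<close>

lemma combine:
  assumes N: "card E \<ge> l + 2" and R: "grid k m R" and Rp: "i \<in> {R (p - 1)<..R p}"
    and b01: "1 \<le> b0" "b0 \<le> q" "q \<le> b1" "b1 \<le> l"
    and st: "s = Min E" "t = Max E"
    and cover: "\<And>a b. (a, b) \<in> ones k l P \<Longrightarrow>
      (a = p \<and> b0 \<le> b \<and> b \<le> b1) \<or>
      ((a, b) \<noteq> (p, q) \<and> b \<le> b0 \<and> {r s (a - 1)<..r s a} \<subseteq> {R (a - 1)<..R a}) \<or>
      ((a, b) \<noteq> (p, q) \<and> b1 \<le> b \<and> {r t (a - 1)<..r t a} \<subseteq> {R (a - 1)<..R a})"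
  shows False
proof -
  have "E \<noteq> {}" using N by auto
  then have s: "s \<in> E" and t: "t \<in> E" using st finite_E by auto
  \<comment> \<open>\<open>many_separators\<close> yields card E - 1 columns, so l + 2 griddings
    provide the columns F 0, ..., F l.\<close>
  obtain N' where N': "card E = Suc N'" "N' \<ge> Suc l" using N by (cases "card E") auto
  obtain F where F: "\<forall>j<N'. s < F j \<and> F j < t \<and> M i (F j)"
    and Finc: "\<forall>j. Suc j < N' \<longrightarrow> F j < F (Suc j)"
    using many_separators[OF subset_refl N'(1)] st by blast
  have F: "s < F j" "F j < t" "M i (F j)" if "j \<le> l" for j using F that N'(2) by auto
  have Finc: "F j < F (Suc j)" if "j < l" for j using Finc that N'(2) by auto
  \<comment> \<open>All separators lie right of block q of \<open>s\<close> and left of block q of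
    \<open>t\<close>; this keeps the three pieces of the boundary below in order.\<close>
  have Fs: "c s q < F j" if "j \<le> l" for j using one_after[OF s] F that by blast
  have Ft: "F j \<le> c t (q - 1)" if "j \<le> l" for j using one_before[OF t] F that by blast
  note cs = grid_c[OF s] and ct = grid_c[OF t]
  note ql = pq_range
  have cstep: "c s b < c s (Suc b)" "c t b < c t (Suc b)" if "b < l" for b
    using cs ct that by (auto simp: grid_def)
  \<comment> \<open>The blocks b0 and b1 are shared: block b0 contains block b0 of \<open>s\<close>
    and also F b0, block b1 contains block b1 of \<open>t\<close> and also F b1. For b0 = b1 = q,
    block q contains block q of both griddings.\<close>
  define C where "C b = (if b < b0 then c s b else if b < b1 then F b else c t b)" for b
  have C_lo: "C b = c s b" if "b < b0" for b using that by (simp add: C_def)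
  have C_mid: "C b = F b" if "b0 \<le> b" "b < b1" for b using that by (simp add: C_def)
  have C_hi: "C b = c t b" if "b1 \<le> b" for b using that b01 by (simp add: C_def)
  have sF: "c s b < F j" if "b \<le> q" "j \<le> l" for b j
    using grid_mono[OF cs that(1)] Fs[OF that(2)] ql by simp
  have Ft': "F j < c t b" if "q \<le> b" "b \<le> l" "j \<le> l" for b j
    using grid_mono[OF ct that(1)] F(2)[OF that(3)] col_e[OF t] that by simp
  have st': "c s b < c t b'" if "b \<le> q" "q \<le> b'" "b' \<le> l" for b b'
    using sF[OF that(1), of 0] Ft'[OF that(2,3), of 0] by simp
  have C: "grid l n C"
  proof (rule gridI)
    show "C 0 = 0" using b01 cs by (simp add: C_def grid_def)
    show "C l = n" using C_hi[of l] b01 ct by (simp add: grid_def)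
    fix b assume b: "b < l"
    consider "Suc b < b0" | "Suc b = b0" "b0 < b1" | "Suc b = b0" "b0 = b1"
      | "b0 \<le> b" "Suc b < b1" | "b0 \<le> b" "Suc b = b1" | "b1 \<le> b"
      using b01 by linarith
    then show "C b < C (Suc b)"
    proof cases
      case 1 then show ?thesis using cstep[OF b] C_lo by simp
    next
      case 2 then show ?thesis using C_lo[of b] C_mid[of "Suc b"] sF[of b "Suc b"] b01 b by simp
    next
      case 3 then show ?thesis using C_lo[of b] C_hi[of "Suc b"] st'[of b "Suc b"] b01 b by simp
    next
      case 4 then show ?thesis using C_mid Finc b by simp
    next
      case 5 then show ?thesis using C_mid[of b] C_hi[of "Suc b"] Ft'[of "Suc b" b] b01 b by simp
    next
      case 6 then show ?thesis using C_hi cstep[OF b] by simp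
    qed
  qed
  have left: "{c s (b - 1)<..c s b} \<subseteq> {C (b - 1)<..C b}" if "1 \<le> b" "b \<le> b0" for b
  proof -
    have "C (b - 1) = c s (b - 1)" using that by (intro C_lo) auto
    moreover have "c s b \<le> C b"
      using C_lo[of b] C_mid[of b] C_hi[of b] sF[of b b] st'[of b b] that b01
      by (cases "b < b0"; cases "b < b1") auto
    ultimately show ?thesis by auto
  qed
  have right: "{c t (b - 1)<..c t b} \<subseteq> {C (b - 1)<..C b}" if "b1 \<le> b" "b \<le> l" for b
  proof -
    have "C b = c t b" using that by (intro C_hi)
    moreover have "C (b - 1) \<le> c t (b - 1)"
    proof (cases "b = b1")
      case True
      have tq: "c t (q - 1) \<le> c t (b1 - 1)" using grid_mono[OF ct] b01 by simp
      show ?thesis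
      proof (cases "b0 < b1")
        case True
        then have "C (b - 1) = F (b - 1)" using C_mid[of "b - 1"] \<open>b = b1\<close> by auto
        moreover have "b - 1 \<le> l" using that by simp
        ultimately show ?thesis using order_trans[OF Ft[of "b - 1"] tq] \<open>b = b1\<close> by simp
      next
        case False
        then have "C (b - 1) = c s (b - 1)" "b = q" using C_lo[of "b - 1"] b01 \<open>b = b1\<close> by auto
        then show ?thesis using sF[of "b - 1" 0] Ft[of 0] by simp
      qed
    next
      case False
      then show ?thesis using C_hi[of "b - 1"] that by simp
    qed
    ultimately show ?thesis by auto
  qed
  have mid: "F b \<in> {C (b - 1)<..C b}" if "b0 \<le> b" "b \<le> b1" for b
  proof -
    have "C (b - 1) < F b"
    proof (cases "b = b0")
      case True
      then show ?thesis using C_lo[of "b - 1"] sF[of "b - 1" b] b01 by simp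
    next
      case False
      then show ?thesis using C_mid[of "b - 1"] Finc[of "b - 1"] that b01 by simp
    qed
    moreover have "F b \<le> C b"
    proof (cases "b = b1")
      case True
      then show ?thesis using C_hi[of b] Ft'[of b b] b01 by simp
    next
      case False
      then show ?thesis using C_mid[of b] that by simp
    qed
    ultimately show ?thesis by simp
  qed
  have "hit M R C a b" if ab: "(a, b) \<in> ones k l P" for a b
    using cover[OF ab]
  proof (elim disjE conjE)
    assume "a = p" "b0 \<le> b" "b \<le> b1"
    then show ?thesis using mid[of b] Rp F(3)[of b] b01 unfolding hit_def by (meson order_trans)
  next
    assume "(a, b) \<noteq> (p, q)" "b \<le> b0" "{r s (a - 1)<..r s a} \<subseteq> {R (a - 1)<..R a}"
    then show ?thesis using hit_mono[OF hits[OF s ab]] left[of b] onesD[OF ab] by blast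
  next
    assume "(a, b) \<noteq> (p, q)" "b1 \<le> b" "{r t (a - 1)<..r t a} \<subseteq> {R (a - 1)<..R a}"
    then show ?thesis using hit_mono[OF hits[OF t ab]] right[of b] onesD[OF ab] by blast
  qed
  then show False using minorI[OF R C] by blast
qed

text \<open>Reflection reverses the order of the columns in \<open>E\<close>, so the griddings are
  reindexed by n + 1 - e. It exchanges the roles of the leftmost and the rightmost gridding.\<close>

lemma flip_cols_family:
  "family k l (flip_cols l P) m n (flip_cols n M) p (l + 1 - q) i ((\<lambda>e. n + 1 - e) ` E)
     (\<lambda>e. r (n + 1 - e)) (\<lambda>e. flip_grid l n (c (n + 1 - e)))"
proof
  show "\<not> interval_minor k l (flip_cols l P) m n (flip_cols n M)"
    using no_minor interval_minor_flip_cols by blast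
  show "(p, l + 1 - q) \<in> ones k l (flip_cols l P)"
    using pq pq_range by (auto simp: ones_flip_cols)
  show "(\<lambda>e. n + 1 - e) ` E \<subseteq> {1..n}" using E_range by fastforce
next
  fix e' assume "e' \<in> (\<lambda>e. n + 1 - e) ` E"
  then obtain e where e: "e \<in> E" "e' = n + 1 - e" by blast
  then have en: "1 \<le> e" "e \<le> n" "n + 1 - e' = e" using E_range by auto
  show "grid k m (r (n + 1 - e'))" using grid_r e en by simp
  show "grid l n (flip_grid l n (c (n + 1 - e')))" using grid_flip[OF grid_c] e en by simp
  show "i \<in> {r (n + 1 - e') (p - 1)<..r (n + 1 - e') p}" using row_i e en by simp
  show "e' \<in> {flip_grid l n (c (n + 1 - e')) (l + 1 - q - 1)<..flip_grid l n (c (n + 1 - e')) (l + 1 - q)}"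
    using window_flip[OF grid_c[OF e(1)] pq_range(3,4) en(1,2)] col_e[OF e(1)] e(2) en(3) by simp
  fix a b assume ab: "(a, b) \<in> ones k l (flip_cols l P)" "(a, b) \<noteq> (p, l + 1 - q)"
  then have b: "b \<in> {1..l}" "(a, l + 1 - b) \<in> ones k l P" by (auto simp: ones_flip_cols)
  moreover have "(a, l + 1 - b) \<noteq> (p, q)" using ab b(1) by auto
  ultimately have "hit M (r e) (c e) a (l + 1 - b)" using hits e by blast
  then show "hit (flip_cols n M) (r (n + 1 - e')) (flip_grid l n (c (n + 1 - e'))) a b"
    using hit_flip_cols[OF grid_c[OF e(1)]] b(1) en(3) by auto
next
  fix e e' assume "e \<in> (\<lambda>e. n + 1 - e) ` E" "e' \<in> (\<lambda>e. n + 1 - e) ` E" "e < e'"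
  then obtain d d' where d: "d \<in> E" "e = n + 1 - d" "d' \<in> E" "e' = n + 1 - d'" "d' < d" by auto
  then obtain f where f: "d' < f" "f < d" "M i f" using separated by blast
  have "d \<le> n" using d E_range by auto
  then have "e < n + 1 - f" "n + 1 - f < e'" "flip_cols n M i (n + 1 - f)"
    using d f by (auto simp: flip_cols_def)
  then show "\<exists>f. e < f \<and> f < e' \<and> flip_cols n M i f" by blast
qed

lemma flip_rows_family:
  "family k l (flip_rows k P) m n (flip_rows m M) (k + 1 - p) q (m + 1 - i) E
     (\<lambda>e. flip_grid k m (r e)) c"
proof
  show "\<not> interval_minor k l (flip_rows k P) m n (flip_rows m M)"
    using no_minor interval_minor_flip_rows by blast
  show "(k + 1 - p, q) \<in> ones k l (flip_rows k P)"
    using pq pq_range by (auto simp: ones_flip_rows)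
  show "E \<subseteq> {1..n}" by (rule E_range)
next
  fix e assume e: "e \<in> E"
  have i: "1 \<le> i" "i \<le> m" using window_in_range[OF grid_r[OF e] pq_range(1,2) row_i[OF e]] by auto
  show "grid k m (flip_grid k m (r e))" using grid_flip[OF grid_r] e by simp
  show "grid l n (c e)" using grid_c e by simp
  show "m + 1 - i \<in> {flip_grid k m (r e) (k + 1 - p - 1)<..flip_grid k m (r e) (k + 1 - p)}"
    using window_flip[OF grid_r[OF e] pq_range(1,2) i] row_i[OF e] by simp
  show "e \<in> {c e (q - 1)<..c e q}" using col_e e by simp
  fix a b assume ab: "(a, b) \<in> ones k l (flip_rows k P)" "(a, b) \<noteq> (k + 1 - p, q)"
  then have b: "a \<in> {1..k}" "(k + 1 - a, b) \<in> ones k l P" by (auto simp: ones_flip_rows)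
  moreover have "(k + 1 - a, b) \<noteq> (p, q)" using ab b(1) by auto
  ultimately have "hit M (r e) (c e) (k + 1 - a) b" using hits e by blast
  then show "hit (flip_rows m M) (flip_grid k m (r e)) (c e) a b"
    using hit_flip_rows[OF grid_r[OF e]] b(1) by auto
next
  fix e e' assume e: "e \<in> E" "e' \<in> E" "e < e'"
  have "i \<le> m" using window_in_range[OF grid_r[OF e(1)] pq_range(1,2) row_i[OF e(1)]] by auto
  then show "\<exists>f. e < f \<and> f < e' \<and> flip_rows m M (m + 1 - i) f"
    using separated[OF e] by (simp add: flip_rows_def)
qed

lemma Min_Max_E:
  assumes "card E \<ge> l + 2"
  shows "Min E \<in> E" "Max E \<in> E"
proof -
  have "E \<noteq> {}" using assms by auto
  then show "Min E \<in> E" "Max E \<in> E" using finite_E by auto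
qed

text \<open>What lies right of q is confined to row p and can be served by row i, so the gridding at
  \<open>Min E\<close> alone supplies all the rest and no rows have to be mixed.\<close>

lemma empty_right:
  assumes N: "card E \<ge> l + 2" and "\<And>a b. (a, b) \<in> ones k l P \<Longrightarrow> q < b \<Longrightarrow> a = p"
  shows False
proof (rule combine[OF N grid_r row_i _ _ _ _ refl refl])
  show "Min E \<in> E" "Min E \<in> E" using Min_Max_E[OF N] by auto
  show "1 \<le> q" "q \<le> q" "q \<le> l" "l \<le> l" using pq_range by auto
  fix a b assume ab: "(a, b) \<in> ones k l P"
  then show "(a = p \<and> q \<le> b \<and> b \<le> l) \<or>
    ((a, b) \<noteq> (p, q) \<and> b \<le> q \<and> {r (Min E) (a - 1)<..r (Min E) a} \<subseteq> {r (Min E) (a - 1)<..r (Min E) a}) \<or>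
    ((a, b) \<noteq> (p, q) \<and> l \<le> b \<and> {r (Max E) (a - 1)<..r (Max E) a} \<subseteq> {r (Min E) (a - 1)<..r (Min E) a})"
    using assms(2)[OF ab] onesD[OF ab] by (cases "b \<le> q") auto
qed

lemma empty_left:
  assumes N: "card E \<ge> l + 2" and "\<And>a b. (a, b) \<in> ones k l P \<Longrightarrow> b < q \<Longrightarrow> a = p"
  shows False
proof (rule combine[OF N grid_r row_i _ _ _ _ refl refl])
  show "Max E \<in> E" "Max E \<in> E" using Min_Max_E[OF N] by auto
  show "1 \<le> (1::nat)" "1 \<le> q" "q \<le> q" "q \<le> l" using pq_range by auto
  fix a b assume ab: "(a, b) \<in> ones k l P"
  then show "(a = p \<and> 1 \<le> b \<and> b \<le> q) \<or>
    ((a, b) \<noteq> (p, q) \<and> b \<le> 1 \<and> {r (Min E) (a - 1)<..r (Min E) a} \<subseteq> {r (Max E) (a - 1)<..r (Max E) a}) \<or>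
    ((a, b) \<noteq> (p, q) \<and> q \<le> b \<and> {r (Max E) (a - 1)<..r (Max E) a} \<subseteq> {r (Max E) (a - 1)<..r (Max E) a})"
    using assms(2)[OF ab] onesD[OF ab] by (cases "q \<le> b") auto
qed

end

section \<open>Cutting and stretching row boundaries\<close>

lemma grid_splice:
  assumes "grid k m r" "grid k m r'" "0 < j" "j \<le> k" "r (j - 1) < r' j"
  shows "grid k m (\<lambda>a. if a < j then r a else r' a)"
proof (rule gridI)
  fix a assume a: "a < k"
  show "(if a < j then r a else r' a) < (if Suc a < j then r (Suc a) else r' (Suc a))"
    using assms a by (cases "Suc a = j") (auto simp: grid_def)
qed (use assms in \<open>auto simp: grid_def\<close>)

text \<open>The blocks above block j shrink to one row each, which leaves all other rows at the top
  to block j. This is harmless when P has no 1-entry above row j.\<close>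

lemma grid_raise_top:
  assumes "grid k m r" "j \<le> k"
  shows "grid k m (\<lambda>a. if a < j then a else r a)"
proof (rule gridI)
  fix a assume a: "a < k"
  show "(if a < j then a else r a) < (if Suc a < j then Suc a else r (Suc a))"
    using assms a grid_ge[OF assms(1), of "Suc a"] by (auto simp: grid_def)
qed (use assms in \<open>auto simp: grid_def\<close>)

text \<open>Mirror image of \<open>grid_raise_top\<close>: the blocks below block j shrink to one
  row each and block j absorbs the rest.\<close>

lemma grid_lower_bottom:
  assumes "grid k m r" "0 < j" "j \<le> k"
  shows "grid k m (\<lambda>a. if a < j then r a else m - (k - a))"
proof (rule gridI)
  have km: "k \<le> m" using grid_ge[OF assms(1), of k] assms(1) by (simp add: grid_def)
  fix a assume a: "a < k"
  have "r a < m - (k - Suc a)" using grid_le_minus[OF assms(1), of a] a by linarith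
  moreover have "m - (k - a) < m - (k - Suc a)" using a km by linarith
  moreover have "r a < r (Suc a)" using a assms(1) by (simp add: grid_def)
  ultimately show "(if a < j then r a else m - (k - a)) < (if Suc a < j then r (Suc a) else m - (k - Suc a))"
    by auto
qed (use assms in \<open>auto simp: grid_def\<close>)

section \<open>Patterns whose independent triples are monotone\<close>

definition monotone_triples :: "(nat \<times> nat) set \<Rightarrow> bool" where
  "monotone_triples S \<longleftrightarrow> (\<forall>a1 b1 a2 b2 a3 b3.
     (a1, b1) \<in> S \<and> (a2, b2) \<in> S \<and> (a3, b3) \<in> S \<and> b1 < b2 \<and> b2 < b3 \<and>
     a1 \<noteq> a2 \<and> a2 \<noteq> a3 \<and> a1 \<noteq> a3 \<longrightarrow> a1 < a2 \<and> a2 < a3 \<or> a3 < a2 \<and> a2 < a1)"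

lemma monotone_triplesD:
  assumes "monotone_triples S" "(a1, b1) \<in> S" "(a2, b2) \<in> S" "(a3, b3) \<in> S"
    and "b1 < b2" "b2 < b3" "a1 \<noteq> a2" "a2 \<noteq> a3" "a1 \<noteq> a3"
  shows "a1 < a2 \<and> a2 < a3 \<or> a3 < a2 \<and> a2 < a1"
  using assms unfolding monotone_triples_def by blast

locale monotone_family = family +
  assumes mono: "monotone_triples (ones k l P)"
    and card_E: "card E \<ge> l + 2"
begin

lemmas triple = monotone_triplesD[OF mono]

abbreviation "s \<equiv> Min E"
abbreviation "t \<equiv> Max E"

lemmas s_in = Min_Max_E(1)[OF card_E] and t_in = Min_Max_E(2)[OF card_E]

text \<open>A 1-entry above row p and right of the leftmost 1-entry of row p would form a
  non-monotone triple with that entry and the 1-entry at the lower right. So row i can serve all of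
  row p, while the rows above p are taken from the first gridding and those below from the
  last.\<close>

lemma diagonal:
  assumes UL: "(a1, b1) \<in> ones k l P" "a1 < p" "b1 < q"
    and DR: "(a2, b2) \<in> ones k l P" "p < a2" "q < b2"
    and UR: "\<And>a b. (a, b) \<in> ones k l P \<Longrightarrow> a < p \<Longrightarrow> b \<le> q"
    and DL: "\<And>a b. (a, b) \<in> ones k l P \<Longrightarrow> p < a \<Longrightarrow> q \<le> b"
  shows False
proof -
  define B where "B = {b. (p, b) \<in> ones k l P}"
  have B: "finite B" "q \<in> B"
    using pq finite_subset[of B "{1..l}"] by (auto simp: B_def ones_def)
  define b0 where "b0 = Min B"
  define b3 where "b3 = Max B"
  have "B \<noteq> {}" using B by blast
  then have "b0 \<in> B" "b3 \<in> B" using B Min_in[of B] Max_in[of B] by (auto simp: b0_def b3_def)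
  then have b03: "(p, b0) \<in> ones k l P" "(p, b3) \<in> ones k l P" by (auto simp: B_def)
  have q: "b0 \<le> q" "q \<le> b3" using B by (auto simp: b0_def b3_def)
  \<comment> \<open>Block p may be cut as in neither gridding: it only has to contain row i, which
    also makes the splice at p legitimate.\<close>
  define R where "R = (\<lambda>a. if a < p then r s a else r t a)"
  show False
  proof (rule combine[OF card_E _ _ _ q _ refl refl])
    show "grid k m R" unfolding R_def
      using grid_splice[OF grid_r[OF s_in] grid_r[OF t_in], of p] row_i[OF s_in] row_i[OF t_in]
        pq_range by auto
    show "i \<in> {R (p - 1)<..R p}"
      using row_i[OF s_in] row_i[OF t_in] pq_range by (auto simp: R_def)
    show "1 \<le> b0" "b3 \<le> l" using onesD b03 by blast+
    fix a b assume ab: "(a, b) \<in> ones k l P"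
    consider "a = p" | "a < p" | "p < a" by linarith
    then show "(a = p \<and> b0 \<le> b \<and> b \<le> b3) \<or>
      ((a, b) \<noteq> (p, q) \<and> b \<le> b0 \<and> {r s (a - 1)<..r s a} \<subseteq> {R (a - 1)<..R a}) \<or>
      ((a, b) \<noteq> (p, q) \<and> b3 \<le> b \<and> {r t (a - 1)<..r t a} \<subseteq> {R (a - 1)<..R a})"
    proof cases
      case 1
      then have "b \<in> B" using ab by (simp add: B_def)
      then show ?thesis using 1 B by (simp add: b0_def b3_def)
    next
      case 2
      have "b \<le> b0" using triple[OF b03(1) ab DR(1)] UR[OF ab 2] DR 2 by force
      then show ?thesis using 2 by (simp add: R_def)
    next
      case 3
      have "b3 \<le> b" using triple[OF UL(1) ab b03(2)] DL[OF ab 3] UL 3 by force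
      then show ?thesis using 3 by (auto simp add: R_def)
    qed
  qed
qed

text \<open>With b0 = b1 = q, block q of the glued columns contains block q of both griddings, so a
  1-entry of column q may come from either. Only row u must accommodate both; its block runs from
  the smaller of the two starts to the larger of the two ends.\<close>

lemma cross:
  assumes u: "1 \<le> u" "u < p"
    and row_p: "\<And>b. (p, b) \<in> ones k l P \<Longrightarrow> b = q"
    and row_u: "\<And>a b. (a, b) \<in> ones k l P \<Longrightarrow> a \<noteq> p \<Longrightarrow> b \<noteq> q \<Longrightarrow> a = u"
  shows False
proof -
  define x where "x = (if r s (u - 1) \<le> r t (u - 1) then s else t)"
  define y where "y = (if r s u \<ge> r t u then s else t)"
  have x: "x = s \<or> x = t" "r x (u - 1) \<le> r s (u - 1)" "r x (u - 1) \<le> r t (u - 1)"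
    and y: "y = s \<or> y = t" "r s u \<le> r y u" "r t u \<le> r y u"
    by (auto simp: x_def y_def)
  have xy: "x \<in> E" "y \<in> E" using x y s_in t_in by auto
  define R where "R = (\<lambda>a. if a < u then r x a else r y a)"
  have "r y (u - 1) < r y u" using grid_less[OF grid_r[OF xy(2)]] u pq_range by simp
  then have "r x (u - 1) < r y u" using x y by auto
  then have R: "grid k m R" unfolding R_def
    using grid_splice[OF grid_r[OF xy(1)] grid_r[OF xy(2)], of u] u pq_range by auto
  show False
  proof (rule combine[OF card_E R _ _ order_refl order_refl _ refl refl])
    show "i \<in> {R (p - 1)<..R p}"
      using row_i[OF xy(2)] u by (auto simp: R_def)
    show "1 \<le> q" "q \<le> l" using pq_range by auto
    fix a b assume ab: "(a, b) \<in> ones k l P"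
    show "(a = p \<and> q \<le> b \<and> b \<le> q) \<or>
      ((a, b) \<noteq> (p, q) \<and> b \<le> q \<and> {r s (a - 1)<..r s a} \<subseteq> {R (a - 1)<..R a}) \<or>
      ((a, b) \<noteq> (p, q) \<and> q \<le> b \<and> {r t (a - 1)<..r t a} \<subseteq> {R (a - 1)<..R a})"
    proof (cases "a = p")
      case True
      then show ?thesis using row_p ab by simp
    next
      case False
      consider "a = u" | "a \<noteq> u" "b = q" using row_u[OF ab False] by blast
      then show ?thesis
      proof cases
        case 1
        then have "{r e (a - 1)<..r e a} \<subseteq> {R (a - 1)<..R a}" if "e = s \<or> e = t" for e
          using that x y u by (auto simp: R_def)
        then show ?thesis using False by (cases "b \<le> q") auto
      next
        case 2
        then have "{r (if a < u then x else y) (a - 1)<..r (if a < u then x else y) a} \<subseteq> {R (a - 1)<..R a}"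
          using u by (auto simp: R_def)
        moreover have "(if a < u then x else y) = s \<or> (if a < u then x else y) = t"
          using x y by auto
        ultimately show ?thesis using False 2 by auto
      qed
    qed
  qed
qed

text \<open>The arms of row p leave no room for mixing row boundaries: all of them come from the
  gridding with the larger block for row u, and 1-entries of row i serve the arm on the other side.\<close>

lemma spine:
  assumes w: "(u, w) \<in> ones k l P" "u < p" "w < q"
    and z: "(u, z) \<in> ones k l P" "q < z"
    and row_u: "\<And>a b. (a, b) \<in> ones k l P \<Longrightarrow> a \<noteq> p \<Longrightarrow> b \<noteq> q \<Longrightarrow> a = u"
    and arm: "(p, b') \<in> ones k l P" "b' \<noteq> q"
    and mid: "(a0, q) \<in> ones k l P" "a0 \<noteq> u" "a0 \<noteq> p"
  shows False
proof -
  \<comment> \<open>A 1-entry of row p on one side of q and the 1-entry of row u on the other side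
    enclose column q, so monotonicity places \<open>a\<close> between their rows.\<close>
  have between: "u < a \<and> a < p" if "(a, q) \<in> ones k l P" "a \<noteq> u" "a \<noteq> p" for a
    using triple[OF arm(1) that(1) z(1)] triple[OF w(1) that(1) arm(1)] w z arm that by force
  then have a0: "u < a0" "a0 < p" using mid by auto
  \<comment> \<open>As row a0 lies between u and p, an arm of row p reaching beyond a 1-entry of row
    u on its side would give a non-monotone triple with (a0, q). Hence each arm stays between q and
    the nearest 1-entry of row u.\<close>
  have left: "b1 \<le> b" if "(p, b) \<in> ones k l P" "b < q" "(u, b1) \<in> ones k l P" "b1 < q" for b b1
    using triple[OF that(1,3) mid(1)] a0 that by force
  have right: "b \<le> b1" if "(p, b) \<in> ones k l P" "q < b" "(u, b1) \<in> ones k l P" "q < b1" for b b1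
    using triple[OF mid(1) that(3,1)] a0 that by force
  have u_le: "u \<le> a" if ab: "(a, b) \<in> ones k l P" for a b
  proof -
    consider "a = u" | "a = p" | "a \<noteq> u" "a \<noteq> p" by blast
    then show ?thesis
    proof cases
      case 3
      then have "b = q" using row_u[OF ab] by blast
      then show ?thesis using between[of a] ab 3 by simp
    qed (use w in auto)
  qed
  have right_le: "b \<le> l" if "(a, b) \<in> ones k l P" for a b using onesD[OF that] by simp
  have u1: "1 \<le> u" using onesD[OF w(1)] by simp
  have low: "u - 1 \<le> r e (u - 1)" if "e \<in> E" for e
    using grid_ge[OF grid_r[OF that], of "u - 1"] w(2) pq_range by simp
  define x where "x = (if r t u \<le> r s u then s else t)"
  have x: "x \<in> E" "r s u \<le> r x u" "r t u \<le> r x u" using s_in t_in by (auto simp: x_def)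
  define R where "R = (\<lambda>a. if a < u then a else r x a)"
  have R: "grid k m R" unfolding R_def
    using grid_raise_top[OF grid_r[OF x(1)], of u] w(2) pq_range by simp
  have Ri: "i \<in> {R (p - 1)<..R p}" using row_i[OF x(1)] w(2) by (auto simp: R_def)
  have win: "{r x (a - 1)<..r x a} \<subseteq> {R (a - 1)<..R a}" if "u \<le> a" for a
    using that low[OF x(1)] u1 by (cases "a = u") (auto simp: R_def)
  have win_u: "{r s (u - 1)<..r s u} \<subseteq> {R (u - 1)<..R u}" "{r t (u - 1)<..r t u} \<subseteq> {R (u - 1)<..R u}"
    using x low[OF s_in] low[OF t_in] u1 by (auto simp: R_def)
  define W where "W = {b. (u, b) \<in> ones k l P \<and> b < q}"
  define Z where "Z = {b. (u, b) \<in> ones k l P \<and> q < b}"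
  have fin: "finite W" "finite Z"
    using finite_subset[of W "{1..l}"] finite_subset[of Z "{1..l}"]
    by (auto simp: W_def Z_def ones_def)
  have ne: "W \<noteq> {}" "Z \<noteq> {}" using w z by (auto simp: W_def Z_def)
  define w0 where "w0 = Max W"
  define z0 where "z0 = Min Z"
  have "w0 \<in> W" "z0 \<in> Z" using fin ne by (auto simp: w0_def z0_def)
  then have w0: "(u, w0) \<in> ones k l P" "w0 < q" and z0: "(u, z0) \<in> ones k l P" "q < z0"
    by (auto simp: W_def Z_def)
  have w0_ge: "b \<le> w0" if "(u, b) \<in> ones k l P" "b < q" for b
    using fin that by (auto simp: w0_def W_def)
  have z0_le: "z0 \<le> b" if "(u, b) \<in> ones k l P" "q < b" for b
    using fin that by (auto simp: z0_def Z_def)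
  show False
  proof (cases "x = s")
    case True
    show False
    \<comment> \<open>The first gridding supplies everything up to column q; from the last one only
      1-entries of row u are taken, starting with the first one right of q.\<close>
    proof (rule combine[OF card_E R Ri _ order_refl _ _ refl refl])
      show "1 \<le> q" "q \<le> z0" "z0 \<le> l" using pq_range z0 right_le by auto
      fix a b assume ab: "(a, b) \<in> ones k l P"
      consider "(a, b) = (p, q)" | "(a, b) \<noteq> (p, q)" "b \<le> q" | "a = p" "q < b" | "a \<noteq> p" "q < b"
        by fastforce
      then show "(a = p \<and> q \<le> b \<and> b \<le> z0) \<or>
        ((a, b) \<noteq> (p, q) \<and> b \<le> q \<and> {r s (a - 1)<..r s a} \<subseteq> {R (a - 1)<..R a}) \<or>
        ((a, b) \<noteq> (p, q) \<and> z0 \<le> b \<and> {r t (a - 1)<..r t a} \<subseteq> {R (a - 1)<..R a})"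
      proof cases
        case 1
        then show ?thesis using z0 by simp
      next
        case 2
        then show ?thesis using win[OF u_le[OF ab]] True by simp
      next
        case 3
        then show ?thesis using right[OF _ _ z0] ab by simp
      next
        case 4
        then have "a = u" using row_u[OF ab] by simp
        then show ?thesis using 4 z0_le[of b] ab win_u by simp
      qed
    qed
  next
    case False
    then have xt: "x = t" by (auto simp: x_def split: if_splits)
    show False
    proof (rule combine[OF card_E R Ri _ _ order_refl _ refl refl])
      show "1 \<le> w0" "w0 \<le> q" "q \<le> l" using onesD[OF w0(1)] w0 pq_range by auto
      fix a b assume ab: "(a, b) \<in> ones k l P"
      consider "(a, b) = (p, q)" | "(a, b) \<noteq> (p, q)" "q \<le> b" | "a = p" "b < q" | "a \<noteq> p" "b < q"
        by fastforce
      then show "(a = p \<and> w0 \<le> b \<and> b \<le> q) \<or>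
        ((a, b) \<noteq> (p, q) \<and> b \<le> w0 \<and> {r s (a - 1)<..r s a} \<subseteq> {R (a - 1)<..R a}) \<or>
        ((a, b) \<noteq> (p, q) \<and> q \<le> b \<and> {r t (a - 1)<..r t a} \<subseteq> {R (a - 1)<..R a})"
      proof cases
        case 1
        then show ?thesis using w0 by simp
      next
        case 2
        then show ?thesis using win[OF u_le[OF ab]] xt by simp
      next
        case 3
        then show ?thesis using left[OF _ _ w0] ab by simp
      next
        case 4
        then have "a = u" using row_u[OF ab] by simp
        then show ?thesis using 4 w0_ge[of b] ab win_u by simp
      qed
    qed
  qed
qed

text \<open>Compared with (p, q), the occupied quadrants pin each other down: the 1-entries of both
  upper ones lie in row u, those of both left ones in column w. Only row u needs blocks of both
  griddings, so the proof splits on which gridding ends this block later.\<close>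

lemma three_quadrants:
  assumes UL: "(u, w) \<in> ones k l P" "u < p" "w < q"
    and UR: "(u', z) \<in> ones k l P" "u' < p" "q < z"
    and DL: "(v, w') \<in> ones k l P" "p < v" "w' < q"
    and DR: "\<And>a b. (a, b) \<in> ones k l P \<Longrightarrow> p < a \<Longrightarrow> b \<le> q"
  shows False
proof -
  have UL_row: "a = u" if "(a, b) \<in> ones k l P" "a < p" "q < b" for a b
    using triple[OF UL(1) pq that(1)] UL that by force
  then have [simp]: "u' = u" using UR by blast
  have DL_col: "b = w" if "(a, b) \<in> ones k l P" "p < a" "b < q" for a b
    using triple[OF UL(1) that(1) pq] triple[OF that(1) UL(1) pq] UL that by force
  then have [simp]: "w' = w" using DL by blast
  define Z where "Z = {z. (u, z) \<in> ones k l P \<and> q < z}"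
  have Z: "finite Z" "z \<in> Z"
    using UR finite_subset[of Z "{1..l}"] by (auto simp: Z_def ones_def)
  define z0 where "z0 = Min Z"
  have "Z \<noteq> {}" using Z by blast
  then have "z0 \<in> Z" using Z Min_in[of Z] by (simp add: z0_def)
  then have z0: "(u, z0) \<in> ones k l P" "q < z0" by (auto simp: Z_def)
  have z0_le: "z0 \<le> b" if "(u, b) \<in> ones k l P" "q < b" for b
    using Z that by (auto simp: z0_def Z_def)
  have UL_only: "a = u \<and> b = w" if "(a, b) \<in> ones k l P" "a < p" "b < q" for a b
    using triple[OF that(1) pq z0(1)] triple[OF that(1) DL(1) pq] triple[OF DL(1) that(1) pq]
      z0 UL DL that by force
  have DLw: "(v, w) \<in> ones k l P" using DL by simp
  have row_p: "w \<le> b" "b \<le> z0" if "(p, b) \<in> ones k l P" for b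
    using triple[OF DLw z0(1) that] triple[OF that DLw z0(1)] z0 UL DL by force+
  \<comment> \<open>Arms of the cross exclude each other: an arm of row p to the right forbids
    further 1-entries in column q, an arm to the left forbids those of column q below row p. This
    settles the choice of b0 and b1 in the second case.\<close>
  have right_arm: "a = p" if "(p, b) \<in> ones k l P" "q < b" "(a, q) \<in> ones k l P" for a b
    using triple[OF DLw that(3,1)] triple[OF UL(1) that(3,1)] UL DL that(2) by force
  have left_arm: "a \<le> p" if "(p, b) \<in> ones k l P" "b < q" "(a, q) \<in> ones k l P" for a b
    using triple[OF that(1,3) z0(1)] UL z0(2) that(2) by force
  have u_le: "u \<le> a" if ab: "(a, b) \<in> ones k l P" for a b
  proof -
    consider "p \<le> a" | "a < p" "b < q" | "a < p" "b = q" | "a < p" "q < b" by linarith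
    then show ?thesis
    proof cases
      case 1
      then show ?thesis using UL by simp
    next
      case 2
      then show ?thesis using UL_only[OF ab] by simp
    next
      case 3
      then show ?thesis using triple[OF DLw ab z0(1)] UL DL z0(2) by force
    next
      case 4
      then show ?thesis using UL_row[OF ab] by simp
    qed
  qed
  have u1: "1 \<le> u" using onesD[OF UL(1)] by simp
  note gs = grid_r[OF s_in] and gt = grid_r[OF t_in]
  have low: "u - 1 \<le> r e (u - 1)" if "e \<in> E" for e
    using grid_ge[OF grid_r[OF that], of "u - 1"] UL(2) pq_range by simp
  have z0l: "z0 \<le> l" using onesD[OF z0(1)] by simp
  have w1: "1 \<le> w" using onesD[OF UL(1)] by simp
  show False
  proof (cases "r t u \<le> r s u")
    case True
    \<comment> \<open>Here \<open>s\<close> ends block u no earlier than \<open>t\<close>, so the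
      rows of \<open>s\<close> also serve the 1-entries of row u taken from
      \<open>t\<close>.\<close>
    define R where "R = (\<lambda>a. if a < u then a else r s a)"
    have R: "grid k m R" unfolding R_def
      using grid_raise_top[OF gs, of u] UL(2) pq_range by simp
    have win: "{r s (a - 1)<..r s a} \<subseteq> {R (a - 1)<..R a}" if "u \<le> a" for a
      using that low[OF s_in] u1 by (cases "a = u") (auto simp: R_def)
    have win_t: "{r t (u - 1)<..r t u} \<subseteq> {R (u - 1)<..R u}"
      using True low[OF t_in] u1 by (auto simp: R_def)
    show False
    proof (rule combine[OF card_E R _ _ order_refl _ z0l refl refl])
      show "i \<in> {R (p - 1)<..R p}" using row_i[OF s_in] UL(2) by (auto simp: R_def)
      show "1 \<le> q" "q \<le> z0" using pq_range z0 by auto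
      fix a b assume ab: "(a, b) \<in> ones k l P"
      consider "(a, b) = (p, q)" | "(a, b) \<noteq> (p, q)" "b \<le> q" | "a = p" "q < b" | "a \<noteq> p" "q < b"
        by fastforce
      then show "(a = p \<and> q \<le> b \<and> b \<le> z0) \<or>
        ((a, b) \<noteq> (p, q) \<and> b \<le> q \<and> {r s (a - 1)<..r s a} \<subseteq> {R (a - 1)<..R a}) \<or>
        ((a, b) \<noteq> (p, q) \<and> z0 \<le> b \<and> {r t (a - 1)<..r t a} \<subseteq> {R (a - 1)<..R a})"
      proof cases
        case 1
        then show ?thesis using z0 by simp
      next
        case 2
        then show ?thesis using win[OF u_le[OF ab]] by simp
      next
        case 3
        then show ?thesis using row_p ab by simp
      next
        case 4
        then have "a < p" using DR[OF ab] by linarith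
        then have "a = u" using UL_row ab 4 by blast
        then show ?thesis using 4 z0_le ab win_t by blast
      qed
    qed
  next
    case False
    \<comment> \<open>Now block u of \<open>t\<close> ends later. The rows above p follow
      \<open>t\<close>; the others follow \<open>s\<close>, because the lower right quadrant is
      empty and the lower left one is reached from the left.\<close>
    define R' where "R' = (\<lambda>a. if a < p then r t a else r s a)"
    define R where "R = (\<lambda>a. if a < u then a else R' a)"
    have "grid k m R'" unfolding R'_def
      using grid_splice[OF gt gs, of p] row_i[OF s_in] row_i[OF t_in] pq_range by auto
    then have R: "grid k m R" unfolding R_def
      using grid_raise_top[of k m R' u] UL(2) pq_range by simp
    \<comment> \<open>Separators extend to a side only if row p has an arm there. The rows of column
      q above p follow \<open>t\<close> and require b1 = q, those below p follow \<open>s\<close>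
      and require b0 = q; \<open>right_arm\<close> and \<open>left_arm\<close> guarantee
      this.\<close>
    define b0 where "b0 = (if \<exists>b<q. (p, b) \<in> ones k l P then w else q)"
    define b1 where "b1 = (if \<exists>b>q. (p, b) \<in> ones k l P then z0 else q)"
    have b01: "w \<le> b0" "b0 \<le> q" "q \<le> b1" "b1 \<le> z0"
      using z0 UL by (auto simp: b0_def b1_def)
    have win_s: "{r s (a - 1)<..r s a} \<subseteq> {R (a - 1)<..R a}" if "a = u \<or> p < a" for a
      using that False low[OF s_in] UL(2) u1 by (auto simp: R_def R'_def)
    have win_t: "{r t (a - 1)<..r t a} \<subseteq> {R (a - 1)<..R a}" if "u \<le> a" "a < p" for a
      using that low[OF t_in] UL(2) u1 by (cases "a = u") (auto simp: R_def R'_def)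
    show False
    proof (rule combine[OF card_E R _ _ b01(2,3) _ refl refl])
      show "i \<in> {R (p - 1)<..R p}"
        using row_i[OF s_in] row_i[OF t_in] UL(2) by (auto simp: R_def R'_def)
      show "1 \<le> b0" "b1 \<le> l" using b01 w1 z0l by auto
      fix a b assume ab: "(a, b) \<in> ones k l P"
      consider "a = p" | "a < p" "b < q" | "a < p" "b = q" | "a < p" "q < b"
        | "p < a" "b < q" | "p < a" "b = q"
        using DR[OF ab] by linarith
      then show "(a = p \<and> b0 \<le> b \<and> b \<le> b1) \<or>
        ((a, b) \<noteq> (p, q) \<and> b \<le> b0 \<and> {r s (a - 1)<..r s a} \<subseteq> {R (a - 1)<..R a}) \<or>
        ((a, b) \<noteq> (p, q) \<and> b1 \<le> b \<and> {r t (a - 1)<..r t a} \<subseteq> {R (a - 1)<..R a})"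
      proof cases
        case 1
        then have "b0 \<le> b" using row_p ab by (auto simp: b0_def not_less)
        moreover have "b \<le> b1" using 1 row_p ab by (auto simp: b1_def not_less)
        ultimately show ?thesis using 1 by simp
      next
        case 2
        then show ?thesis using UL_only[OF ab] b01 win_s by auto
      next
        case 3
        then have "b1 = q" using right_arm ab unfolding b1_def by auto
        then show ?thesis using 3 win_t u_le[OF ab] by auto
      next
        case 4
        then have "a = u" using UL_row ab by blast
        then show ?thesis using 4 z0_le[of b] ab b01 win_t[of u] by simp
      next
        case 5
        then show ?thesis using DL_col[OF ab] b01 win_s by auto
      next
        case 6
        then have "b0 = q" using left_arm ab unfolding b0_def by (meson leD)
        then show ?thesis using 6 win_s by auto
      qed
    qed
  qed
qed

text \<open>The 1-entries off row p and column q are four corners in rows u, v and columns w, z, and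
  all others lie in the rectangle they span. Block u can be stretched to the top and block v to the
  bottom, so both contain the blocks of both griddings. The remaining conflict, between arms of row
  p and of column q, is excluded by \<open>arms\<close>.\<close>

lemma four_quadrants:
  assumes UL: "(u, w) \<in> ones k l P" "u < p" "w < q"
    and UR: "(u', z) \<in> ones k l P" "u' < p" "q < z"
    and DL: "(v, w') \<in> ones k l P" "p < v" "w' < q"
    and DR: "(v', z') \<in> ones k l P" "p < v'" "q < z'"
  shows False
proof -
  have row_eq: "a = a'"
    if "(a, b) \<in> ones k l P" "(a', b') \<in> ones k l P" "b < q" "q < b'" "a < p \<and> a' < p \<or> p < a \<and> p < a'"
    for a b a' b'
    using triple[OF that(1) pq that(2)] that by force
  have col_eq: "b = b'"
    if "(a, b) \<in> ones k l P" "(a', b') \<in> ones k l P" "a < p" "p < a'" "b < q \<and> b' < q \<or> q < b \<and> q < b'"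
    for a b a' b'
    using triple[OF that(1,2) pq] triple[OF that(2,1) pq] triple[OF pq that(1,2)] triple[OF pq that(2,1)]
      that by force
  have [simp]: "u' = u" "v' = v" "w' = w" "z' = z"
    using row_eq[OF UL(1) UR(1)] row_eq[OF DL(1) DR(1)] col_eq[OF UL(1) DL(1)] col_eq[OF UR(1) DR(1)]
      UL UR DL DR by auto
  have uz: "(u, z) \<in> ones k l P" and vw: "(v, w) \<in> ones k l P" and vz: "(v, z) \<in> ones k l P"
    using UR DL DR by auto
  have quadrants: "(a = u \<or> a = v) \<and> (b = w \<or> b = z)" if ab: "(a, b) \<in> ones k l P" "a \<noteq> p" "b \<noteq> q" for a b
  proof -
    consider "a < p" "b < q" | "a < p" "q < b" | "p < a" "b < q" | "p < a" "q < b"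
      using ab by linarith
    then show ?thesis
    proof cases
      case 1
      then show ?thesis using row_eq[OF ab(1) uz] col_eq[OF ab(1) vw] UL UR DL by auto
    next
      case 2
      then show ?thesis using row_eq[OF UL(1) ab(1)] col_eq[OF ab(1) vz] UL UR DR by auto
    next
      case 3
      then show ?thesis using row_eq[OF ab(1) vz] col_eq[OF UL(1) ab(1)] UL DL DR by auto
    next
      case 4
      then show ?thesis using row_eq[OF vw ab(1)] col_eq[OF uz ab(1)] UR DL DR by auto
    qed
  qed
  have col_q: "u \<le> a" "a \<le> v" if "(a, q) \<in> ones k l P" for a
    using triple[OF vw that uz] triple[OF UL(1) that vz] UL DL UR DR by force+
  \<comment> \<open>Two perpendicular arms bound a quadrant, and with the corner diagonally opposite
    to it they form a non-monotone triple.\<close>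
  have arms: "a = p \<or> b = q" if "(p, b) \<in> ones k l P" "(a, q) \<in> ones k l P" for a b
  proof (rule ccontr)
    assume "\<not> (a = p \<or> b = q)"
    then consider "b < q" "a < p" | "b < q" "p < a" | "q < b" "a < p" | "q < b" "p < a" by linarith
    then show False
    proof cases
      case 1 then show ?thesis using triple[OF that vz] DR by force
    next
      case 2 then show ?thesis using triple[OF that uz] UR UL by force
    next
      case 3 then show ?thesis using triple[OF vw that(2,1)] DL by force
    next
      case 4 then show ?thesis using triple[OF UL(1) that(2,1)] UL by force
    qed
  qed
  have row_p: "w \<le> b" "b \<le> z" if "(p, b) \<in> ones k l P" for b
    using triple[OF that vw uz] triple[OF vw uz that] UL UR DL DR by force+
  define x where "x = (if r s u \<ge> r t u then s else t)"
  define y where "y = (if r s (v - 1) \<le> r t (v - 1) then s else t)"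
  have x: "x = s \<or> x = t" "r s u \<le> r x u" "r t u \<le> r x u"
    and y: "y = s \<or> y = t" "r y (v - 1) \<le> r s (v - 1)" "r y (v - 1) \<le> r t (v - 1)"
    by (auto simp: x_def y_def)
  have xy: "x \<in> E" "y \<in> E" using x y s_in t_in by auto
  define R1 where "R1 = (\<lambda>a. if a < p then r x a else r y a)"
  define R2 where "R2 = (\<lambda>a. if a < v then R1 a else m - (k - a))"
  define R where "R = (\<lambda>a. if a < u then a else R2 a)"
  have v: "v \<le> k" "1 \<le> u" using onesD UL(1) DL(1) by auto
  have "grid k m R1" unfolding R1_def
    using grid_splice[OF grid_r[OF xy(1)] grid_r[OF xy(2)], of p] row_i[OF xy(1)] row_i[OF xy(2)]
      pq_range by auto
  then have "grid k m R2" unfolding R2_def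
    using grid_lower_bottom[of k m R1 v] v DL(2) by simp
  then have R: "grid k m R" unfolding R_def
    using grid_raise_top[of k m R2 u] UL(2) pq_range by simp
  have Ri: "i \<in> {R (p - 1)<..R p}"
    using row_i[OF xy(1)] row_i[OF xy(2)] UL(2) DL(2) by (auto simp: R_def R2_def R1_def)
  have st: "e \<in> E" if "e = s \<or> e = t" for e using that s_in t_in by blast
  have win_u: "{r e (u - 1)<..r e u} \<subseteq> {R (u - 1)<..R u}" if "e = s \<or> e = t" for e
  proof -
    have "u - 1 \<le> r e (u - 1)"
      using grid_ge[OF grid_r[OF st[OF that]], of "u - 1"] UL(2) pq_range by simp
    moreover have "r e u \<le> r x u" using that x by auto
    ultimately show ?thesis using UL(2) DL(2) v by (auto simp: R_def R2_def R1_def)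
  qed
  have win_v: "{r e (v - 1)<..r e v} \<subseteq> {R (v - 1)<..R v}" if "e = s \<or> e = t" for e
  proof -
    have "r e v \<le> m - (k - v)"
      using grid_le_minus[OF grid_r[OF st[OF that]], of v] v by simp
    moreover have "r y (v - 1) \<le> r e (v - 1)" using that y by auto
    ultimately show ?thesis using UL(2) DL(2) v by (auto simp: R_def R2_def R1_def)
  qed
  have win: "\<exists>e. (e = s \<or> e = t) \<and> {r e (a - 1)<..r e a} \<subseteq> {R (a - 1)<..R a}"
    if a: "u \<le> a" "a \<le> v" "a \<noteq> p" for a
  proof -
    consider "a = u" | "a = v" | "u < a" "a < p" | "p < a" "a < v"
      using a by linarith
    then show ?thesis
    proof cases
      case 3
      then have "{r x (a - 1)<..r x a} \<subseteq> {R (a - 1)<..R a}"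
        using DL(2) by (auto simp: R_def R2_def R1_def)
      then show ?thesis using x by blast
    next
      case 4
      then have "{r y (a - 1)<..r y a} \<subseteq> {R (a - 1)<..R a}"
        using UL(2) by (auto simp: R_def R2_def R1_def)
      then show ?thesis using y by blast
    qed (use win_u win_v in blast)+
  qed
  have corner: "((a, b) \<noteq> (p, q) \<and> b \<le> b0 \<and> {r s (a - 1)<..r s a} \<subseteq> {R (a - 1)<..R a}) \<or>
    ((a, b) \<noteq> (p, q) \<and> b1 \<le> b \<and> {r t (a - 1)<..r t a} \<subseteq> {R (a - 1)<..R a})"
    if "(a, b) \<in> ones k l P" "a \<noteq> p" "b \<noteq> q" "w \<le> b0" "b1 \<le> z" for a b b0 b1
    using quadrants[OF that(1-3)] win_u win_v that by auto
  show False
  proof (cases "\<forall>b. (p, b) \<in> ones k l P \<longrightarrow> b = q")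
    case True
    show False
    proof (rule combine[OF card_E R Ri _ order_refl order_refl _ refl refl])
      show "1 \<le> q" "q \<le> l" using pq_range by auto
      fix a b assume ab: "(a, b) \<in> ones k l P"
      consider "a = p" | "a \<noteq> p" "b = q" | "a \<noteq> p" "b \<noteq> q" by blast
      then show "(a = p \<and> q \<le> b \<and> b \<le> q) \<or>
        ((a, b) \<noteq> (p, q) \<and> b \<le> q \<and> {r s (a - 1)<..r s a} \<subseteq> {R (a - 1)<..R a}) \<or>
        ((a, b) \<noteq> (p, q) \<and> q \<le> b \<and> {r t (a - 1)<..r t a} \<subseteq> {R (a - 1)<..R a})"
      proof cases
        case 1
        then show ?thesis using True ab by simp
      next
        case 2
        then show ?thesis using win[of a] col_q[of a] ab by auto
      next
        case 3
        show ?thesis using corner[OF ab 3, of q q] UL UR by auto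
      qed
    qed
  next
    case False
    then have col: "a = p" if "(a, q) \<in> ones k l P" for a using arms that by blast
    show False
    proof (rule combine[OF card_E R Ri _ _ _ _ refl refl])
      show "1 \<le> w" "w \<le> q" "q \<le> z" "z \<le> l" using onesD[OF UL(1)] onesD[OF uz] UL UR by auto
      fix a b assume ab: "(a, b) \<in> ones k l P"
      consider "a = p" | "a \<noteq> p" "b \<noteq> q" using col ab by blast
      then show "(a = p \<and> w \<le> b \<and> b \<le> z) \<or>
        ((a, b) \<noteq> (p, q) \<and> b \<le> w \<and> {r s (a - 1)<..r s a} \<subseteq> {R (a - 1)<..R a}) \<or>
        ((a, b) \<noteq> (p, q) \<and> z \<le> b \<and> {r t (a - 1)<..r t a} \<subseteq> {R (a - 1)<..R a})"
      proof cases
        case 1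
        then show ?thesis using row_p ab by simp
      next
        case 2
        show ?thesis using corner[OF ab 2, of w z] by auto
      qed
    qed
  qed
qed

end

section \<open>Patterns with two nonempty rows\<close>

context family
begin

text \<open>A partial embedding of the first h columns of P to the left of column y, with the row
  boundaries already fixed: the state of the column-by-column construction.\<close>

definition fits :: "(nat \<Rightarrow> nat) \<Rightarrow> nat \<Rightarrow> nat \<Rightarrow> bool" where
  "fits R h y \<longleftrightarrow> (\<exists>C. C 0 = 0 \<and> (\<forall>j<h. C j < C (Suc j)) \<and> C h < y \<and>
     (\<forall>a b. (a, b) \<in> ones k l P \<longrightarrow> b \<le> h \<longrightarrow> hit M R C a b))"

lemma fitsE:
  assumes "fits R h y"
  obtains C where "C 0 = 0" "\<And>j. j < h \<Longrightarrow> C j < C (Suc j)" "C h < y"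
    "\<And>a b. (a, b) \<in> ones k l P \<Longrightarrow> b \<le> h \<Longrightarrow> hit M R C a b"
  using assms unfolding fits_def by blast

lemma fits_mono: "fits R h y \<Longrightarrow> y \<le> y' \<Longrightarrow> fits R h y'"
  unfolding fits_def by (meson order.strict_trans2)

lemma fits_extend:
  assumes C: "C 0 = 0" "\<And>j. j < h \<Longrightarrow> C j < C (Suc j)"
    "\<And>a b. (a, b) \<in> ones k l P \<Longrightarrow> b \<le> h \<Longrightarrow> hit M R C a b"
    and z: "C h < z" "z < y"
    and new: "\<And>a. (a, Suc h) \<in> ones k l P \<Longrightarrow> \<exists>x\<in>{R (a - 1)<..R a}. \<exists>y\<in>{C h<..z}. M x y"
  shows "fits R (Suc h) y"
  unfolding fits_def
proof (intro exI conjI allI impI)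
  let ?C = "\<lambda>j. if j \<le> h then C j else z"
  show "?C 0 = 0" "?C (Suc h) < y" using C z by auto
  show "?C j < ?C (Suc j)" if "j < Suc h" for j using that C z by (cases "j = h") auto
  fix a b assume ab: "(a, b) \<in> ones k l P" "b \<le> Suc h"
  show "hit M R ?C a b"
  proof (cases "b = Suc h")
    case True
    then show ?thesis using new ab by (simp add: hit_def)
  next
    case False
    then have "b \<le> h" using ab by simp
    then show ?thesis using C(3)[OF ab(1)] by (auto simp: hit_def)
  qed
qed

end

locale two_row_family = family +
  fixes u :: nat
  assumes rows: "\<And>a b. (a, b) \<in> ones k l P \<Longrightarrow> a = u \<or> a = p"
    and u: "1 \<le> u" "u < p"
    and increasing: "\<And>e e'. e \<in> E \<Longrightarrow> e' \<in> E \<Longrightarrow> e \<le> e' \<Longrightarrow> r e u \<le> r e' u"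
begin

text \<open>The rows above u are empty in P, so the block of row u may start as early as possible.\<close>

definition RT :: "nat \<Rightarrow> nat \<Rightarrow> nat" where
  "RT T = (\<lambda>a. if a < u then a else r T a)"

lemma grid_RT: "T \<in> E \<Longrightarrow> grid k m (RT T)"
  unfolding RT_def using grid_raise_top[OF grid_r] u pq_range by simp

lemma row_i_RT: "T \<in> E \<Longrightarrow> i \<in> {RT T (p - 1)<..RT T p}"
  using row_i u by (auto simp: RT_def)

lemma window_u_RT:
  assumes "T \<in> E" "T' \<in> E" "T' \<le> T"
  shows "{r T' (u - 1)<..r T' u} \<subseteq> {RT T (u - 1)<..RT T u}"
proof -
  have "u - 1 \<le> r T' (u - 1)" using grid_ge[OF grid_r[OF assms(2)], of "u - 1"] u pq_range by simp
  then show ?thesis using increasing[OF assms(2,1,3)] u by (auto simp: RT_def)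
qed

lemma window_RT:
  assumes "T \<in> E" "(a, b) \<in> ones k l P"
  shows "{r T (a - 1)<..r T a} \<subseteq> {RT T (a - 1)<..RT T a}"
proof -
  have "a = u \<or> a = p" using rows[OF assms(2)] .
  then show ?thesis
  proof
    assume "a = u"
    then show ?thesis using window_u_RT[OF assms(1,1)] by simp
  next
    assume "a = p"
    then show ?thesis using u by (auto simp: RT_def)
  qed
qed

lemma before_e:
  assumes "e \<in> E" "h < q"
  shows "c e h < e"
proof -
  have "c e h \<le> c e (q - 1)"
    using assms(2) pq_range by (intro grid_mono[OF grid_c[OF assms(1)]]) auto
  then show ?thesis using col_e[OF assms(1)] by simp
qed

text \<open>If T' admits no embedding of column h + 1 before the second column of A, then the 1-entry for
  (u, h + 1) in its own gridding lies between A's second column and T', and it serves all later T,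
  because their upper row block is larger.\<close>

lemma fits_step:
  assumes A: "A \<subseteq> E" "card A \<ge> 2 * N + 2" and fit: "\<And>T. T \<in> A \<Longrightarrow> fits (RT T) h (Min A)"
    and h: "Suc h < q"
  shows "\<exists>A'\<subseteq>A. card A' \<ge> N \<and> (\<forall>T\<in>A'. fits (RT T) (Suc h) (Min A'))"
proof -
  have fin: "finite A" using A finite_E finite_subset by blast
  have "A \<noteq> {}" using A by auto
  define a1 where "a1 = Min A"
  have a1: "a1 \<in> A" using fin \<open>A \<noteq> {}\<close> by (simp add: a1_def)
  define A1 where "A1 = A - {a1}"
  have cardA1: "card A1 \<ge> 2 * N + 1" using A a1 fin by (simp add: A1_def)
  then have neA1: "A1 \<noteq> {}" by auto
  have finA1: "finite A1" using fin by (simp add: A1_def)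
  define a2 where "a2 = Min A1"
  have a2: "a2 \<in> A1" using neA1 finA1 by (simp add: a2_def)
  have a1_le: "a1 \<le> T" if "T \<in> A" for T using that fin by (simp add: a1_def)
  have a2_le: "a2 \<le> T" if "T \<in> A1" for T using that finA1 by (simp add: a2_def)
  have "a1 < a2" using a1_le[of a2] a2 by (auto simp: A1_def)
  then obtain f where f: "a1 < f" "f < a2" "M i f"
    using separated[of a1 a2] a1 a2 A by (auto simp: A1_def)
  \<comment> \<open>Of the at least 2N + 1 elements of \<open>A1\<close>, either N admit the next
    column before a2 or N + 1 do not; in the second case one is spent as \<open>T'\<close>.\<close>
  define H where "H = {T\<in>A1. fits (RT T) (Suc h) a2}"
  have H: "H \<subseteq> A1" by (auto simp: H_def)
  have finH: "finite H" using H finA1 finite_subset by blast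
  show ?thesis
  proof (cases "N \<le> card H")
    case True
    have "fits (RT T) (Suc h) (Min H)" if T: "T \<in> H" for T
    proof -
      have "H \<noteq> {}" using T by blast
      then have "a2 \<le> Min H" using finH H a2_le by (meson Min_in subsetD)
      moreover have "fits (RT T) (Suc h) a2" using T by (simp add: H_def)
      ultimately show ?thesis using fits_mono by blast
    qed
    then show ?thesis using True H by (auto simp: A1_def)
  next
    case False
    define G where "G = A1 - H"
    have finG: "finite G" using finA1 by (simp add: G_def)
    have cardG: "card G \<ge> N + 1"
      using False cardA1 card_Diff_subset[OF finH H] by (simp add: G_def)
    then have "G \<noteq> {}" by auto
    define T' where "T' = Min G"
    have T': "T' \<in> G" using finG \<open>G \<noteq> {}\<close> by (simp add: T'_def)
    then have T'A: "T' \<in> A1" "T' \<in> A" "T' \<in> E" "\<not> fits (RT T') (Suc h) a2"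
      using A by (auto simp: G_def H_def A1_def)
    have f_ok: "\<exists>x\<in>{RT T (p - 1)<..RT T p}. \<exists>y\<in>{C h<..z}. M x y"
      if "T \<in> E" "C h < a1" "f \<le> z" for T z and C :: "nat \<Rightarrow> nat"
    proof (intro bexI)
      show "M i f" by (rule f)
      show "f \<in> {C h<..z}" using that f by auto
    qed (rule row_i_RT[OF that(1)])
    \<comment> \<open>C has to end no later than block h of \<open>T'\<close>, so that block h + 1
      of \<open>T'\<close> is still available to its right. If the boundaries of \<open>T'\<close>
      do not themselves end before a1, the given fit ends before them.\<close>
    obtain C where C: "C 0 = 0" "\<And>j. j < h \<Longrightarrow> C j < C (Suc j)" "C h < a1"
      and C_le: "C h \<le> c T' h"
      and C_hit: "\<And>a b. (a, b) \<in> ones k l P \<Longrightarrow> b \<le> h \<Longrightarrow> hit M (RT T') C a b"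
    proof (cases "c T' h < a1")
      case True
      have cg: "grid l n (c T')" using grid_c T'A by blast
      have "hit M (RT T') (c T') a b" if ab: "(a, b) \<in> ones k l P" "b \<le> h" for a b
      proof (rule hit_mono[OF hits[OF T'A(3) ab(1)]])
        show "(a, b) \<noteq> (p, q)" using ab h by auto
        show "{r T' (a - 1)<..r T' a} \<subseteq> {RT T' (a - 1)<..RT T' a}"
          using window_RT[OF T'A(3) ab(1)] .
      qed simp
      moreover have "c T' j < c T' (Suc j)" if "j < h" for j
        using cg that h pq_range by (auto simp: grid_def)
      ultimately show ?thesis using that[of "c T'"] True cg by (auto simp: grid_def)
    next
      case False
      from fit[OF T'A(2)] show ?thesis
      proof (rule fitsE)
        fix C assume "C 0 = 0" "\<And>j. j < h \<Longrightarrow> C j < C (Suc j)" "C h < Min A"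
          "\<And>a b. (a, b) \<in> ones k l P \<Longrightarrow> b \<le> h \<Longrightarrow> hit M (RT T') C a b"
        then show ?thesis using that[of C] False by (simp add: a1_def)
      qed
    qed
    \<comment> \<open>Otherwise the separator f alone would complete column h + 1 before a2, against
      the choice of \<open>T'\<close>.\<close>
    have "(u, Suc h) \<in> ones k l P"
    proof (rule ccontr)
      assume no: "(u, Suc h) \<notin> ones k l P"
      have "fits (RT T') (Suc h) a2"
      proof (rule fits_extend[OF C(1,2) C_hit])
        show "C h < f" "f < a2" using C f by auto
        fix a assume "(a, Suc h) \<in> ones k l P"
        then have "a = p" using rows no by blast
        then show "\<exists>x\<in>{RT T' (a - 1)<..RT T' a}. \<exists>y\<in>{C h<..f}. M x y"
          using f_ok[of T' C, OF T'A(3) C(3)] by simp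
      qed auto
      then show False using T'A by blast
    qed
    then have "hit M (r T') (c T') u (Suc h)" using hits[OF T'A(3)] u by auto
    then obtain x y where x: "x \<in> {r T' (u - 1)<..r T' u}" and y: "c T' h < y" "y \<le> c T' (Suc h)"
      and Mxy: "M x y"
      by (auto simp: hit_def)
    have y_ge: "a2 \<le> y"
    proof (rule ccontr)
      assume less: "\<not> a2 \<le> y"
      have "fits (RT T') (Suc h) a2"
      proof (rule fits_extend[OF C(1,2) C_hit])
        \<comment> \<open>The new boundary must include f, for a 1-entry in row p, as well as y, for
          the one in row u.\<close>
        show "C h < max y f" "max y f < a2" using C f less by auto
        fix a assume "(a, Suc h) \<in> ones k l P"
        then consider "a = p" | "a = u" using rows by blast
        then show "\<exists>x\<in>{RT T' (a - 1)<..RT T' a}. \<exists>z\<in>{C h<..max y f}. M x z"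
        proof cases
          case 1
          then show ?thesis using f_ok[of T' C, OF T'A(3) C(3)] by simp
        next
          case 2
          then have "x \<in> {RT T' (a - 1)<..RT T' a}" using x window_u_RT[of T' T'] T'A by blast
          moreover have "y \<in> {C h<..max y f}" using y C_le by auto
          ultimately show ?thesis using Mxy by blast
        qed
      qed auto
      then show False using T'A by blast
    qed
    have yT': "y < T'" using y before_e[OF T'A(3) h] by simp
    define A' where "A' = G - {T'}"
    have A'sub: "A' \<subseteq> A" by (auto simp: A'_def G_def A1_def)
    have "card A' \<ge> N" using cardG T' finG by (simp add: A'_def)
    moreover have "fits (RT T) (Suc h) (Min A')" if T: "T \<in> A'" for T
    proof -
      have TE: "T \<in> A" "T \<in> E" using T A'sub A by auto
      have later: "T' < T''" if "T'' \<in> A'" for T''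
        using that finG Min_le[of G T''] by (auto simp: A'_def T'_def order.order_iff_strict)
      have "Min A' \<in> A'" using T finG by (intro Min_in) (auto simp: A'_def)
      then have T'min: "T' < Min A'" using later by blast
      from fit[OF TE(1)] show ?thesis
      proof (rule fitsE)
        fix D assume D: "D 0 = 0" "\<And>j. j < h \<Longrightarrow> D j < D (Suc j)" "D h < Min A"
          and D_hit: "\<And>a b. (a, b) \<in> ones k l P \<Longrightarrow> b \<le> h \<Longrightarrow> hit M (RT T) D a b"
        have Da: "D h < a1" using D by (simp add: a1_def)
        show ?thesis
        proof (rule fits_extend[OF D(1,2) D_hit])
          show "D h < y" using Da y_ge \<open>a1 < a2\<close> by simp
          then have yD: "y \<in> {D h<..y}" by simp
          show "y < Min A'" using yT' T'min by simp
          fix a assume "(a, Suc h) \<in> ones k l P"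
          then consider "a = p" | "a = u" using rows by blast
          then show "\<exists>x\<in>{RT T (a - 1)<..RT T a}. \<exists>z\<in>{D h<..y}. M x z"
          proof cases
            case 1
            then show ?thesis using f_ok[of T D y] TE(2) Da f y_ge by simp
          next
            case 2
            have "T' \<le> T" using later[OF T] by simp
            then have "x \<in> {RT T (a - 1)<..RT T a}"
              using 2 x window_u_RT[OF TE(2) T'A(3)] by blast
            then show ?thesis using Mxy yD by blast
          qed
        qed auto
      qed
    qed
    ultimately show ?thesis using A'sub by blast
  qed
qed

text \<open>One step turns 2N + 2 griddings into N, and 2N + 2 \<le> 4N for N \<ge> 1, whence a
  factor 4 per column.\<close>

lemma fits_many:
  assumes "h < q" "1 \<le> N" "card E \<ge> 4 ^ h * N"
  shows "\<exists>A\<subseteq>E. card A \<ge> N \<and> (\<forall>T\<in>A. fits (RT T) h (Min A))"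
  using assms
proof (induction h arbitrary: N)
  case 0
  have "E \<noteq> {}" using 0 by auto
  then have "Min E \<in> E" using finite_E by simp
  then have "0 < Min E" using E_range by auto
  then have "fits R 0 (Min E)" for R
    unfolding fits_def by (intro exI[of _ "\<lambda>_. 0"]) (auto dest: onesD)
  then show ?case using 0 by auto
next
  case (Suc h)
  have "2 * N + 2 \<le> 4 * N" using Suc.prems by simp
  then have "4 ^ h * (2 * N + 2) \<le> 4 ^ h * (4 * N)" by (rule mult_le_mono2)
  moreover have "4 ^ Suc h * N = 4 ^ h * (4 * N)" by simp
  ultimately have "card E \<ge> 4 ^ h * (2 * N + 2)" using Suc.prems(3) by linarith
  then obtain A where A: "A \<subseteq> E" "card A \<ge> 2 * N + 2" "\<forall>T\<in>A. fits (RT T) h (Min A)"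
    using Suc.IH[of "2 * N + 2"] Suc.prems by auto
  then show ?case using fits_step[OF A(1,2) _ Suc.prems(1)] by (meson order_trans)
qed

text \<open>Two surviving griddings e < T suffice: the first q - 1 columns are embedded left of e, a
  separator between e and T plays (p, q), and T itself supplies the other 1-entries from column q
  on.\<close>

lemma card_less: "card E < 4 ^ q * 2"
proof (rule ccontr)
  assume "\<not> card E < 4 ^ q * 2"
  moreover have "(4::nat) ^ (q - 1) \<le> 4 ^ q" by (rule power_increasing) auto
  ultimately have "card E \<ge> 4 ^ (q - 1) * 2" by linarith
  then obtain A where A: "A \<subseteq> E" "card A \<ge> 2" and fit: "\<forall>T\<in>A. fits (RT T) (q - 1) (Min A)"
    using fits_many[of "q - 1" 2] pq_range by auto
  have fin: "finite A" using A finite_E finite_subset by blast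
  have "A \<noteq> {}" using A by auto
  define e where "e = Min A"
  define T where "T = Max A"
  have eT: "e \<in> A" "T \<in> A" using fin \<open>A \<noteq> {}\<close> by (auto simp: e_def T_def)
  have "e \<noteq> T"
  proof
    assume "e = T"
    then have "x = e" if "x \<in> A" for x
      using Min_le[OF fin that] Max_ge[OF fin that] by (simp add: e_def T_def)
    then have "A \<subseteq> {e}" by blast
    then show False using A(2) card_mono[of "{e}" A] by simp
  qed
  then have "e < T" using Min_le[OF fin eT(2)] by (simp add: e_def)
  then obtain f where f: "e < f" "f < T" "M i f" using separated eT A by blast
  have TE: "T \<in> E" using eT A by blast
  note ct = grid_c[OF TE]
  have fc: "f \<le> c T (q - 1)" using one_before[OF TE f(3,2)] .
  have cq: "c T (q - 1) < c T q" using grid_less[OF ct] pq_range by simp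
  from fit[rule_format, OF eT(2)] show False
  proof (rule fitsE)
    fix D assume D: "D 0 = 0" "\<And>j. j < q - 1 \<Longrightarrow> D j < D (Suc j)" "D (q - 1) < Min A"
      and D_hit: "\<And>a b. (a, b) \<in> ones k l P \<Longrightarrow> b \<le> q - 1 \<Longrightarrow> hit M (RT T) D a b"
    have De: "D (q - 1) < e" using D by (simp add: e_def)
    define C where "C = (\<lambda>j. if j < q then D j else c T j)"
    have C: "grid l n C"
    proof (rule gridI)
      show "C 0 = 0" using D pq_range by (simp add: C_def)
      show "C l = n" using ct pq_range by (simp add: C_def grid_def)
      fix b assume b: "b < l"
      consider "Suc b < q" | "Suc b = q" | "q \<le> b" by linarith
      then show "C b < C (Suc b)"
      proof cases
        case 1
        then show ?thesis using D(2)[of b] by (simp add: C_def)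
      next
        case 2
        then show ?thesis using De f fc cq by (auto simp: C_def)
      next
        case 3
        then show ?thesis using ct b by (simp add: C_def grid_def)
      qed
    qed
    have "hit M (RT T) C a b" if ab: "(a, b) \<in> ones k l P" for a b
    proof -
      consider "b < q" | "(a, b) = (p, q)" | "(a, b) \<noteq> (p, q)" "q \<le> b" by fastforce
      then show ?thesis
      proof cases
        case 1
        then have "hit M (RT T) D a b" by (intro D_hit[OF ab]) auto
        then show ?thesis using 1 by (auto simp: hit_def C_def)
      next
        case 2
        have "f \<in> {C (q - 1)<..C q}" using De f fc cq pq_range by (simp add: C_def)
        then show ?thesis using 2 row_i_RT[OF TE] f(3) unfolding hit_def by blast
      next
        case 3
        have "C (b - 1) \<le> c T (b - 1)"
          using De f fc 3 by (cases "b = q") (auto simp: C_def)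
        then have "{c T (b - 1)<..c T b} \<subseteq> {C (b - 1)<..C b}" using 3 by (auto simp: C_def)
        then show ?thesis
          using hit_mono[OF hits[OF TE ab 3(1)] window_RT[OF TE ab]] by blast
      qed
    qed
    then show False using minorI[OF grid_RT[OF TE] C] by blast
  qed
qed

end

section \<open>Bounding the size of a family\<close>

definition bounded_at :: "nat \<Rightarrow> nat \<Rightarrow> (nat \<Rightarrow> nat \<Rightarrow> bool) \<Rightarrow> nat \<Rightarrow> nat \<Rightarrow> bool" where
  "bounded_at k l P p q \<longleftrightarrow>
    (\<exists>N. \<forall>m n M i E r c. family k l P m n M p q i E r c \<longrightarrow> card E \<le> N)"

lemma bounded_at_flip_cols:
  assumes "bounded_at k l (flip_cols l P) p (l + 1 - q)"
  shows "bounded_at k l P p q"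
proof -
  obtain N where N: "\<And>m n M i E r c. family k l (flip_cols l P) m n M p (l + 1 - q) i E r c \<Longrightarrow> card E \<le> N"
    using assms unfolding bounded_at_def by blast
  have "card E \<le> N" if fam: "family k l P m n M p q i E r c" for m n M i E r c
  proof -
    have "inj_on (\<lambda>e. n + 1 - e) E"
      using family.E_range[OF fam] by (fastforce simp: inj_on_def)
    then have "card ((\<lambda>e. n + 1 - e) ` E) = card E" by (rule card_image)
    then show ?thesis using N[OF family.flip_cols_family[OF fam]] by simp
  qed
  then show ?thesis unfolding bounded_at_def by blast
qed

lemma bounded_at_flip_rows:
  assumes "bounded_at k l (flip_rows k P) (k + 1 - p) q"
  shows "bounded_at k l P p q"
  using assms family.flip_rows_family unfolding bounded_at_def by metis

lemma monotone_triples_flip_cols: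
  assumes "monotone_triples (ones k l P)"
  shows "monotone_triples (ones k l (flip_cols l P))"
  unfolding monotone_triples_def
proof (intro allI impI, elim conjE)
  fix a1 b1 a2 b2 a3 b3
  assume h: "(a1, b1) \<in> ones k l (flip_cols l P)" "(a2, b2) \<in> ones k l (flip_cols l P)"
    "(a3, b3) \<in> ones k l (flip_cols l P)" "b1 < b2" "b2 < b3" "a1 \<noteq> a2" "a2 \<noteq> a3" "a1 \<noteq> a3"
  then have P: "(a3, l + 1 - b3) \<in> ones k l P" "(a2, l + 1 - b2) \<in> ones k l P"
    "(a1, l + 1 - b1) \<in> ones k l P" "l + 1 - b3 < l + 1 - b2" "l + 1 - b2 < l + 1 - b1"
    by (auto simp: ones_flip_cols)
  have "a3 < a2 \<and> a2 < a1 \<or> a1 < a2 \<and> a2 < a3"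
    by (rule monotone_triplesD[OF assms P]) (use h in auto)
  then show "a1 < a2 \<and> a2 < a3 \<or> a3 < a2 \<and> a2 < a1" by blast
qed

lemma monotone_triples_flip_rows:
  assumes "monotone_triples (ones k l P)"
  shows "monotone_triples (ones k l (flip_rows k P))"
  unfolding monotone_triples_def
proof (intro allI impI, elim conjE)
  fix a1 b1 a2 b2 a3 b3
  assume h: "(a1, b1) \<in> ones k l (flip_rows k P)" "(a2, b2) \<in> ones k l (flip_rows k P)"
    "(a3, b3) \<in> ones k l (flip_rows k P)" "b1 < b2" "b2 < b3" "a1 \<noteq> a2" "a2 \<noteq> a3" "a1 \<noteq> a3"
  then have P: "(k + 1 - a1, b1) \<in> ones k l P" "(k + 1 - a2, b2) \<in> ones k l P"
    "(k + 1 - a3, b3) \<in> ones k l P" and a: "a1 \<in> {1..k}" "a2 \<in> {1..k}" "a3 \<in> {1..k}"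
    by (auto simp: ones_flip_rows)
  have "k + 1 - a1 \<noteq> k + 1 - a2" "k + 1 - a2 \<noteq> k + 1 - a3" "k + 1 - a1 \<noteq> k + 1 - a3"
    using h(6-8) a by auto
  then have "k + 1 - a1 < k + 1 - a2 \<and> k + 1 - a2 < k + 1 - a3 \<or>
      k + 1 - a3 < k + 1 - a2 \<and> k + 1 - a2 < k + 1 - a1"
    by (intro monotone_triplesD[OF assms P h(4,5)])
  then show "a1 < a2 \<and> a2 < a3 \<or> a3 < a2 \<and> a2 < a1" by auto
qed

text \<open>The bound is l + 1, because families of l + 2 columns are where gluing starts to
  work.\<close>

lemma bounded_atI:
  assumes "monotone_triples (ones k l P)"
    and "\<And>m n M i E r c. monotone_family k l P m n M p q i E r c \<Longrightarrow> False"
  shows "bounded_at k l P p q"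
proof -
  have "card E \<le> l + 1" if fam: "family k l P m n M p q i E r c" for m n M i E r c
  proof (rule ccontr)
    assume "\<not> card E \<le> l + 1"
    then have "monotone_family k l P m n M p q i E r c"
      using assms(1) fam by (simp add: monotone_family_def monotone_family_axioms_def)
    then show False by (rule assms(2))
  qed
  then show ?thesis unfolding bounded_at_def by blast
qed

text \<open>Pairs e < e' are coloured by whether r e u \<le> r e' u. On a clique the boundary
  increases weakly; on an independent set it decreases, and reflecting the columns turns this into
  an increase.\<close>

lemma bounded_two_rows:
  assumes rows: "\<And>a b. (a, b) \<in> ones k l P \<Longrightarrow> a = u \<or> a = p" and u: "1 \<le> u" "u < p"
  shows "bounded_at k l P p q"
proof -
  \<comment> \<open>The exponent l dominates both q and l + 1 - q, the column of the distinguished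
    1-entry before and after the reflection.\<close>
  define K :: nat where "K = 4 ^ l * 2"
  obtain N where N: "\<And>(V :: nat set) F. finite V \<Longrightarrow> card V \<ge> N \<Longrightarrow>
      \<exists>S\<subseteq>V. card S = K \<and> clique S F \<or> card S = K \<and> indep S F"
    using ramsey2[of K K, where ?'a = nat] by blast
  have "card E \<le> N" if fam: "family k l P m n M p q i E r c" for m n M i E r c
  proof (rule ccontr)
    assume "\<not> card E \<le> N"
    define F where "F = {{e, e'} | e e'. e < e' \<and> r e u \<le> r e' u}"
    have F_iff: "{e, e'} \<in> F \<longleftrightarrow> r e u \<le> r e' u" if "e < e'" for e e'
      using that by (auto simp: F_def doubleton_eq_iff)
    obtain S where S: "S \<subseteq> E" "card S = K" "clique S F \<or> indep S F"
      using N[OF family.finite_E[OF fam], of F] \<open>\<not> card E \<le> N\<close> by auto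
    interpret S: family k l P m n M p q i S r c
      by (rule family.family_subset[OF fam S(1)])
    have K_ge: "4 ^ j * 2 \<le> K" if "j \<le> l" for j
      using power_increasing[OF that, of "4::nat"] by (simp add: K_def)
    show False
    proof (cases "clique S F")
      case True
      interpret two_row_family k l P m n M p q i S r c u
      proof
        fix e e' assume "e \<in> S" "e' \<in> S" "e \<le> e'"
        then show "r e u \<le> r e' u"
          using True F_iff[of e e'] unfolding clique_def by (cases "e = e'") auto
      qed (use rows u in auto)
      show False using card_less K_ge[of q] S(2) S.pq_range by simp
    next
      case False
      then have ind: "indep S F" using S by blast
      interpret F: family k l "flip_cols l P" m n "flip_cols n M" p "l + 1 - q" i
        "(\<lambda>e. n + 1 - e) ` S" "\<lambda>e. r (n + 1 - e)" "\<lambda>e. flip_grid l n (c (n + 1 - e))"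
        by (rule S.flip_cols_family)
      interpret F: two_row_family k l "flip_cols l P" m n "flip_cols n M" p "l + 1 - q" i
        "(\<lambda>e. n + 1 - e) ` S" "\<lambda>e. r (n + 1 - e)" "\<lambda>e. flip_grid l n (c (n + 1 - e))" u
      proof
        fix a b assume "(a, b) \<in> ones k l (flip_cols l P)"
        then show "a = u \<or> a = p" using rows by (auto simp: ones_flip_cols)
      next
        fix e e' assume e: "e \<in> (\<lambda>e. n + 1 - e) ` S" "e' \<in> (\<lambda>e. n + 1 - e) ` S" "e \<le> e'"
        then obtain d d' where d: "d \<in> S" "e = n + 1 - d" "d' \<in> S" "e' = n + 1 - d'" by auto
        have range: "d \<in> {1..n}" "d' \<in> {1..n}" using d S.E_range by auto
        then have "n + 1 - e = d" "n + 1 - e' = d'" "d' \<le> d" using d e by auto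
        moreover have "r d u \<le> r d' u" if "d' < d"
          using ind F_iff[OF that] d that unfolding indep_def by fastforce
        ultimately show "r (n + 1 - e) u \<le> r (n + 1 - e') u" by (cases "d' = d") auto
      qed (use u in auto)
      have "inj_on (\<lambda>e. n + 1 - e) S" using S.E_range by (fastforce simp: inj_on_def)
      then have "card ((\<lambda>e. n + 1 - e) ` S) = card S" by (rule card_image)
      moreover have "4 ^ (l + 1 - q) * 2 \<le> K" using S.pq_range by (intro K_ge) simp
      ultimately show False using F.card_less S(2) by linarith
    qed
  qed
  then show ?thesis unfolding bounded_at_def by blast
qed

section \<open>Case distinction by the occupied quadrants\<close>

definition NW :: "(nat \<times> nat) set \<Rightarrow> nat \<Rightarrow> nat \<Rightarrow> bool" where
  "NW S p q \<longleftrightarrow> (\<exists>(a, b)\<in>S. a < p \<and> b < q)"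
definition NE :: "(nat \<times> nat) set \<Rightarrow> nat \<Rightarrow> nat \<Rightarrow> bool" where
  "NE S p q \<longleftrightarrow> (\<exists>(a, b)\<in>S. a < p \<and> q < b)"
definition SW :: "(nat \<times> nat) set \<Rightarrow> nat \<Rightarrow> nat \<Rightarrow> bool" where
  "SW S p q \<longleftrightarrow> (\<exists>(a, b)\<in>S. p < a \<and> b < q)"
definition SE :: "(nat \<times> nat) set \<Rightarrow> nat \<Rightarrow> nat \<Rightarrow> bool" where
  "SE S p q \<longleftrightarrow> (\<exists>(a, b)\<in>S. p < a \<and> q < b)"

lemmas quadrant_defs = NW_def NE_def SW_def SE_def

lemma ex_ones_flip_cols:
  "(\<exists>(a, b)\<in>ones k l (flip_cols l P). Q a b) \<longleftrightarrow> (\<exists>(a, b)\<in>ones k l P. Q a (l + 1 - b))"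
proof
  assume "\<exists>(a, b)\<in>ones k l (flip_cols l P). Q a b"
  then obtain a b where "(a, b) \<in> ones k l (flip_cols l P)" "Q a b" by blast
  then have "(a, l + 1 - b) \<in> ones k l P" "Q a (l + 1 - (l + 1 - b))"
    by (auto simp: ones_flip_cols)
  then show "\<exists>(a, b)\<in>ones k l P. Q a (l + 1 - b)" by blast
next
  assume "\<exists>(a, b)\<in>ones k l P. Q a (l + 1 - b)"
  then obtain a b where ab: "(a, b) \<in> ones k l P" "Q a (l + 1 - b)" by blast
  then have "(a, l + 1 - b) \<in> ones k l (flip_cols l P)"
    using onesD[OF ab(1)] by (auto simp: ones_flip_cols)
  then show "\<exists>(a, b)\<in>ones k l (flip_cols l P). Q a b" using ab by blast
qed

lemma ex_ones_flip_rows: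
  "(\<exists>(a, b)\<in>ones k l (flip_rows k P). Q a b) \<longleftrightarrow> (\<exists>(a, b)\<in>ones k l P. Q (k + 1 - a) b)"
proof
  assume "\<exists>(a, b)\<in>ones k l (flip_rows k P). Q a b"
  then obtain a b where "(a, b) \<in> ones k l (flip_rows k P)" "Q a b" by blast
  then have "(k + 1 - a, b) \<in> ones k l P" "Q (k + 1 - (k + 1 - a)) b"
    by (auto simp: ones_flip_rows)
  then show "\<exists>(a, b)\<in>ones k l P. Q (k + 1 - a) b" by blast
next
  assume "\<exists>(a, b)\<in>ones k l P. Q (k + 1 - a) b"
  then obtain a b where ab: "(a, b) \<in> ones k l P" "Q (k + 1 - a) b" by blast
  then have "(k + 1 - a, b) \<in> ones k l (flip_rows k P)"
    using onesD[OF ab(1)] by (auto simp: ones_flip_rows)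
  then show "\<exists>(a, b)\<in>ones k l (flip_rows k P). Q a b" using ab by blast
qed

lemma quadrants_flip_cols:
  assumes "1 \<le> q" "q \<le> l"
  shows "NW (ones k l (flip_cols l P)) p (l + 1 - q) \<longleftrightarrow> NE (ones k l P) p q"
    and "NE (ones k l (flip_cols l P)) p (l + 1 - q) \<longleftrightarrow> NW (ones k l P) p q"
    and "SW (ones k l (flip_cols l P)) p (l + 1 - q) \<longleftrightarrow> SE (ones k l P) p q"
    and "SE (ones k l (flip_cols l P)) p (l + 1 - q) \<longleftrightarrow> SW (ones k l P) p q"
proof -
  have "l + 1 - b < l + 1 - q \<longleftrightarrow> q < b" "l + 1 - q < l + 1 - b \<longleftrightarrow> b < q" if "(a, b) \<in> ones k l P" for a b
    using onesD[OF that] assms by auto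
  then show "NW (ones k l (flip_cols l P)) p (l + 1 - q) \<longleftrightarrow> NE (ones k l P) p q"
    "NE (ones k l (flip_cols l P)) p (l + 1 - q) \<longleftrightarrow> NW (ones k l P) p q"
    "SW (ones k l (flip_cols l P)) p (l + 1 - q) \<longleftrightarrow> SE (ones k l P) p q"
    "SE (ones k l (flip_cols l P)) p (l + 1 - q) \<longleftrightarrow> SW (ones k l P) p q"
    unfolding quadrant_defs ex_ones_flip_cols by blast+
qed

lemma quadrants_flip_rows:
  assumes "1 \<le> p" "p \<le> k"
  shows "NW (ones k l (flip_rows k P)) (k + 1 - p) q \<longleftrightarrow> SW (ones k l P) p q"
    and "NE (ones k l (flip_rows k P)) (k + 1 - p) q \<longleftrightarrow> SE (ones k l P) p q"
    and "SW (ones k l (flip_rows k P)) (k + 1 - p) q \<longleftrightarrow> NW (ones k l P) p q"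
    and "SE (ones k l (flip_rows k P)) (k + 1 - p) q \<longleftrightarrow> NE (ones k l P) p q"
proof -
  have "k + 1 - a < k + 1 - p \<longleftrightarrow> p < a" "k + 1 - p < k + 1 - a \<longleftrightarrow> a < p" if "(a, b) \<in> ones k l P" for a b
    using onesD[OF that] assms by auto
  then show "NW (ones k l (flip_rows k P)) (k + 1 - p) q \<longleftrightarrow> SW (ones k l P) p q"
    "NE (ones k l (flip_rows k P)) (k + 1 - p) q \<longleftrightarrow> SE (ones k l P) p q"
    "SW (ones k l (flip_rows k P)) (k + 1 - p) q \<longleftrightarrow> NW (ones k l P) p q"
    "SE (ones k l (flip_rows k P)) (k + 1 - p) q \<longleftrightarrow> NE (ones k l P) p q"
    unfolding quadrant_defs ex_ones_flip_rows by blast+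
qed

lemma bounded_diagonal:
  assumes mono: "monotone_triples (ones k l P)"
    and "NW (ones k l P) p q" "SE (ones k l P) p q" "\<not> NE (ones k l P) p q" "\<not> SW (ones k l P) p q"
  shows "bounded_at k l P p q"
proof (rule bounded_atI[OF mono])
  fix m n M i E r c assume "monotone_family k l P m n M p q i E r c"
  then interpret monotone_family k l P m n M p q i E r c .
  obtain a1 b1 a2 b2 where
    "(a1, b1) \<in> ones k l P" "a1 < p" "b1 < q" "(a2, b2) \<in> ones k l P" "p < a2" "q < b2"
    using assms(2,3) unfolding quadrant_defs by blast
  then show False
  proof (rule diagonal)
    fix a b assume ab: "(a, b) \<in> ones k l P"
    show "b \<le> q" if "a < p" using that ab assms(4) unfolding quadrant_defs by (metis (no_types, lifting) case_prodI not_less)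
    show "q \<le> b" if "p < a" using that ab assms(5) unfolding quadrant_defs by (metis (no_types, lifting) case_prodI not_less)
  qed
qed

lemma bounded_three_quadrants:
  assumes mono: "monotone_triples (ones k l P)"
    and "NW (ones k l P) p q" "NE (ones k l P) p q" "SW (ones k l P) p q" "\<not> SE (ones k l P) p q"
  shows "bounded_at k l P p q"
proof (rule bounded_atI[OF mono])
  fix m n M i E r c assume "monotone_family k l P m n M p q i E r c"
  then interpret monotone_family k l P m n M p q i E r c .
  obtain u w u' z v w' where
    "(u, w) \<in> ones k l P" "u < p" "w < q" "(u', z) \<in> ones k l P" "u' < p" "q < z"
    "(v, w') \<in> ones k l P" "p < v" "w' < q"
    using assms(2-4) unfolding quadrant_defs by blast
  then show False
  proof (rule three_quadrants)
    show "b \<le> q" if "(a, b) \<in> ones k l P" "p < a" for a b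
      using that assms(5) unfolding quadrant_defs by (metis (no_types, lifting) case_prodI not_less)
  qed
qed

lemma bounded_four_quadrants:
  assumes mono: "monotone_triples (ones k l P)"
    and "NW (ones k l P) p q" "NE (ones k l P) p q" "SW (ones k l P) p q" "SE (ones k l P) p q"
  shows "bounded_at k l P p q"
proof (rule bounded_atI[OF mono])
  fix m n M i E r c assume "monotone_family k l P m n M p q i E r c"
  then interpret monotone_family k l P m n M p q i E r c .
  show False
    using four_quadrants assms(2-5) unfolding quadrant_defs by blast
qed

text \<open>The two upper quadrants share a single row u. If only the rows u and p occur, monotone
  triples say nothing and \<open>bounded_two_rows\<close> takes over. Otherwise a third row has its
  1-entry in column q, and the presence of an arm in row p decides between \<open>cross\<close> and
  \<open>spine\<close>.\<close>

lemma bounded_upper_quadrants: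
  assumes mono: "monotone_triples (ones k l P)" and pq: "(p, q) \<in> ones k l P"
    and "NW (ones k l P) p q" "NE (ones k l P) p q" "\<not> SW (ones k l P) p q" "\<not> SE (ones k l P) p q"
  shows "bounded_at k l P p q"
proof -
  obtain u w where w: "(u, w) \<in> ones k l P" "u < p" "w < q"
    using assms(3) unfolding quadrant_defs by blast
  have NE_row: "a = u" if "(a, b) \<in> ones k l P" "a < p" "q < b" for a b
    using monotone_triplesD[OF mono w(1) pq that(1)] w that by force
  then obtain z where z: "(u, z) \<in> ones k l P" "q < z"
    using assms(4) unfolding quadrant_defs by blast
  have NW_row: "a = u" if "(a, b) \<in> ones k l P" "a < p" "b < q" for a b
    using monotone_triplesD[OF mono that(1) pq z(1)] w z that by force
  have row_u: "a = u" if "(a, b) \<in> ones k l P" "a \<noteq> p" "b \<noteq> q" for a b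
  proof -
    have "a < p" using that assms(5,6) unfolding quadrant_defs by (fastforce simp: neq_iff)
    then show ?thesis using NE_row NW_row that by (metis neq_iff)
  qed
  have u: "1 \<le> u" using onesD[OF w(1)] by simp
  show ?thesis
  proof (cases "\<forall>(a, b)\<in>ones k l P. a = u \<or> a = p")
    case True
    then show ?thesis using bounded_two_rows[OF _ u w(2)] by blast
  next
    case False
    then obtain a b where ab: "(a, b) \<in> ones k l P" "a \<noteq> u" "a \<noteq> p" by blast
    then have aq: "(a, q) \<in> ones k l P" using row_u by (cases "b = q") auto
    show ?thesis
    proof (rule bounded_atI[OF mono])
      fix m n M i E r c assume "monotone_family k l P m n M p q i E r c"
      then interpret monotone_family k l P m n M p q i E r c .
      show False
      proof (cases "\<forall>b. (p, b) \<in> ones k l P \<longrightarrow> b = q")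
        case True
        then show False using row_u by (intro cross[OF u w(2)]) blast+
      next
        case False
        then obtain b' where arm: "(p, b') \<in> ones k l P" "b' \<noteq> q" by blast
        show False by (rule spine[OF w z _ arm aq ab(2,3)]) (rule row_u)
      qed
    qed
  qed
qed

text \<open>Up to reflections, the sixteen ways to occupy the quadrants reduce to five: one side
  without 1-entries off row p, two opposite quadrants, both upper quadrants alone, three quadrants,
  all four.\<close>

lemma bounded_at_monotone:
  assumes mono: "monotone_triples (ones k l P)" and pq: "(p, q) \<in> ones k l P"
  shows "bounded_at k l P p q"
proof -
  let ?S = "ones k l P"
  note range = onesD[OF pq]
  note cols = quadrants_flip_cols[OF range(3,4), of k P p]
  note rows = quadrants_flip_rows[OF range(1,2), of l P q]
  note mono_c = monotone_triples_flip_cols[OF mono] and mono_r = monotone_triples_flip_rows[OF mono]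
  have pq_r: "(k + 1 - p, q) \<in> ones k l (flip_rows k P)"
    using pq range by (auto simp: ones_flip_rows)
  have three: "bounded_at k l P p q" if "NW ?S p q" "NE ?S p q" "SW ?S p q \<or> SE ?S p q"
  proof -
    consider "SW ?S p q" "\<not> SE ?S p q" | "\<not> SW ?S p q" "SE ?S p q" | "SW ?S p q" "SE ?S p q"
      using \<open>SW ?S p q \<or> SE ?S p q\<close> by blast
    then show ?thesis
    proof cases
      case 1
      then show ?thesis using bounded_three_quadrants[OF mono] that by blast
    next
      case 2
      have "bounded_at k l (flip_cols l P) p (l + 1 - q)"
        by (rule bounded_three_quadrants[OF mono_c], unfold cols) (use 2 that in blast)+
      then show ?thesis by (rule bounded_at_flip_cols)
    next
      case 3
      then show ?thesis using bounded_four_quadrants[OF mono] that by blast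
    qed
  qed
  have three_lower: "bounded_at k l P p q"
    if "SW ?S p q" "SE ?S p q" "NW ?S p q \<or> NE ?S p q" "\<not> (NW ?S p q \<and> NE ?S p q)"
  proof (rule bounded_at_flip_rows)
    consider "NW ?S p q" "\<not> NE ?S p q" | "\<not> NW ?S p q" "NE ?S p q"
      using \<open>NW ?S p q \<or> NE ?S p q\<close> \<open>\<not> (NW ?S p q \<and> NE ?S p q)\<close> by blast
    then show "bounded_at k l (flip_rows k P) (k + 1 - p) q"
    proof cases
      case 1
      show ?thesis
        by (rule bounded_three_quadrants[OF mono_r], unfold rows) (use 1 that in blast)+
    next
      case 2
      have "bounded_at k l (flip_cols l (flip_rows k P)) (k + 1 - p) (l + 1 - q)"
        by (rule bounded_three_quadrants[OF monotone_triples_flip_cols[OF mono_r]],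
            unfold quadrants_flip_cols[OF range(3,4)] rows)
          (use 2 that in blast)+
      then show ?thesis by (rule bounded_at_flip_cols)
    qed
  qed
  consider "\<not> NW ?S p q" "\<not> SW ?S p q" | "\<not> NE ?S p q" "\<not> SE ?S p q"
    | "NW ?S p q" "NE ?S p q" "SW ?S p q \<or> SE ?S p q"
    | "SW ?S p q" "SE ?S p q" "NW ?S p q \<or> NE ?S p q" "\<not> (NW ?S p q \<and> NE ?S p q)"
    | "NW ?S p q" "NE ?S p q" "\<not> SW ?S p q" "\<not> SE ?S p q"
    | "SW ?S p q" "SE ?S p q" "\<not> NW ?S p q" "\<not> NE ?S p q"
    | "NW ?S p q" "SE ?S p q" "\<not> NE ?S p q" "\<not> SW ?S p q"
    | "NE ?S p q" "SW ?S p q" "\<not> NW ?S p q" "\<not> SE ?S p q"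
    by blast
  then show ?thesis
  proof cases
    case 1
    show ?thesis
    proof (rule bounded_atI[OF mono])
      fix m n M i E r c assume "monotone_family k l P m n M p q i E r c"
      then interpret monotone_family k l P m n M p q i E r c .
      show False
        using empty_left[OF card_E] 1 unfolding quadrant_defs by (metis (no_types, lifting) case_prodI neq_iff)
    qed
  next
    case 2
    show ?thesis
    proof (rule bounded_atI[OF mono])
      fix m n M i E r c assume "monotone_family k l P m n M p q i E r c"
      then interpret monotone_family k l P m n M p q i E r c .
      show False
        using empty_right[OF card_E] 2 unfolding quadrant_defs by (metis (no_types, lifting) case_prodI neq_iff)
    qed
  next
    case 3
    then show ?thesis by (rule three)
  next
    case 4
    then show ?thesis by (rule three_lower)
  next
    case 5
    then show ?thesis by (rule bounded_upper_quadrants[OF mono pq])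
  next
    case 6
    have "bounded_at k l (flip_rows k P) (k + 1 - p) q"
      by (rule bounded_upper_quadrants[OF mono_r pq_r], unfold rows) (use 6 in blast)+
    then show ?thesis by (rule bounded_at_flip_rows)
  next
    case 7
    then show ?thesis by (rule bounded_diagonal[OF mono])
  next
    case 8
    have "bounded_at k l (flip_cols l P) p (l + 1 - q)"
      by (rule bounded_diagonal[OF mono_c], unfold cols) (use 8 in blast)+
    then show ?thesis by (rule bounded_at_flip_cols)
  qed
qed

section \<open>Zero runs of critical matrices\<close>

text \<open>The gridding is not one of M, so some 1-entry of P relies on the new 1-entry; as blocks
  are disjoint, no second one does.\<close>

lemma critical_gridding:
  assumes crit: "critical_Av k l P m n M" and i: "i \<in> {1..m}" and e: "e \<in> {1..n}" "\<not> M i e"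
  shows "\<exists>p q r c. (p, q) \<in> ones k l P \<and> grid k m r \<and> grid l n c \<and>
    i \<in> {r (p - 1)<..r p} \<and> e \<in> {c (q - 1)<..c q} \<and>
    (\<forall>(a, b)\<in>ones k l P. (a, b) \<noteq> (p, q) \<longrightarrow> hit M r c a b)"
proof -
  have no_minor: "\<not> interval_minor k l P m n M"
    using crit by (simp add: critical_Av_def avoids_def)
  have "interval_minor k l P m n (set_one M i e)"
    using crit i e by (simp add: critical_Av_def avoids_def)
  then obtain r c where r: "grid k m r" and c: "grid l n c"
    and h: "\<forall>(a, b)\<in>ones k l P. hit (set_one M i e) r c a b"
    unfolding interval_minor_iff by blast
  have used: "i \<in> {r (a - 1)<..r a} \<and> e \<in> {c (b - 1)<..c b}"
    if "(a, b) \<in> ones k l P" "\<not> hit M r c a b" for a b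
    using h that unfolding hit_def set_one_def by (fastforce split: if_splits)
  obtain p q where pq: "(p, q) \<in> ones k l P" "\<not> hit M r c p q"
    using no_minor r c unfolding interval_minor_iff by blast
  have unique: "a = a'"
    if "grid k m r" "1 \<le> a" "a \<le> k" "1 \<le> a'" "a' \<le> k" "x \<in> {r (a - 1)<..r a}" "x \<in> {r (a' - 1)<..r a'}"
    for k m r a a' and x :: nat
  proof (rule ccontr)
    assume "a \<noteq> a'"
    then consider "a \<le> a' - 1" | "a' \<le> a - 1" by linarith
    then show False
    proof cases
      case 1
      then have "r a \<le> r (a' - 1)" using that by (intro grid_mono[OF that(1)]) auto
      then show False using that by simp
    next
      case 2
      then have "r a' \<le> r (a - 1)" using that by (intro grid_mono[OF that(1)]) auto
      then show False using that by simp
    qed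
  qed
  have "hit M r c a b" if ab: "(a, b) \<in> ones k l P" "(a, b) \<noteq> (p, q)" for a b
  proof (rule ccontr)
    assume "\<not> hit M r c a b"
    then have "a = p" "b = q"
      using unique[OF r, of a p i] unique[OF c, of b q e] used[OF ab(1)] used[OF pq]
        onesD[OF ab(1)] onesD[OF pq(1)] by auto
    then show False using ab by simp
  qed
  then show ?thesis using pq r c used[OF pq] by blast
qed

lemma zero_runs_interval:
  assumes "S \<in> zero_runs n M i"
  obtains b where "Min S \<le> b" "S = {Min S..b}"
proof -
  obtain a b where ab: "a \<le> b" "S = {a..b}"
    using assms unfolding zero_runs_def zero_block_def by blast
  moreover have "Min {a..b} = a" using ab by (intro Min_eqI) auto
  ultimately show thesis using that[of b] by simp
qed

lemma zero_runs_zero: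
  assumes "S \<in> zero_runs n M i" "j \<in> S"
  shows "j \<in> {1..n}" "\<not> M i j"
  using assms unfolding zero_runs_def zero_block_def by auto

lemma zero_runs_maximal:
  assumes "S \<in> zero_runs n M i" "S \<subseteq> {a..b}" "a \<le> b" "{a..b} \<subseteq> {1..n}" "\<And>j. j \<in> {a..b} \<Longrightarrow> \<not> M i j"
  shows "S = {a..b}"
  using assms unfolding zero_runs_def zero_block_def by blast

lemma zero_runs_Min_in:
  assumes "S \<in> zero_runs n M i"
  shows "Min S \<in> S"
proof -
  obtain b where "Min S \<le> b" "S = {Min S..b}" using zero_runs_interval[OF assms] .
  then show ?thesis by (metis atLeastAtMost_iff order_refl)
qed

text \<open>Runs with the same start are nested, hence equal by maximality. So runs can be counted
  by their first columns.\<close>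

lemma inj_on_Min_zero_runs: "inj_on Min (zero_runs n M i)"
proof (rule inj_onI)
  fix S T assume S: "S \<in> zero_runs n M i" and T: "T \<in> zero_runs n M i" and eq: "Min S = Min T"
  obtain b where b: "Min S \<le> b" "S = {Min S..b}" using zero_runs_interval[OF S] .
  obtain b' where b': "Min T \<le> b'" "T = {Min T..b'}" using zero_runs_interval[OF T] .
  have sub: "S \<subseteq> T \<or> T \<subseteq> S" using b b' eq by (metis atLeastatMost_subset_iff nle_le)
  have "zero_block n M i S" "zero_block n M i T" using S T by (auto simp: zero_runs_def)
  then show "S = T" using sub S T unfolding zero_runs_def by blast
qed

text \<open>Without such a 1-entry, T could be extended leftwards to Min S, against its
  maximality.\<close>

lemma zero_runs_separated:
  assumes S: "S \<in> zero_runs n M i" and T: "T \<in> zero_runs n M i" and less: "Min S < Min T"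
  shows "\<exists>f. Min S < f \<and> f < Min T \<and> M i f"
proof (rule ccontr)
  assume no: "\<not> ?thesis"
  obtain b where b: "Min T \<le> b" "T = {Min T..b}" using zero_runs_interval[OF T] .
  have zero: "j \<in> {1..n} \<and> \<not> M i j" if j: "j \<in> {Min S..b}" for j
  proof -
    consider "j = Min S" | "Min S < j" "j < Min T" | "j \<in> T"
      using j b by (metis atLeastAtMost_iff le_neq_implies_less linorder_not_less)
    then show ?thesis
    proof cases
      case 1
      then show ?thesis using zero_runs_zero[OF S zero_runs_Min_in[OF S]] by simp
    next
      case 2
      then show ?thesis
        using no zero_runs_zero(1)[OF S zero_runs_Min_in[OF S]] zero_runs_zero(1)[OF T zero_runs_Min_in[OF T]]
        by auto
    next
      case 3
      then show ?thesis using zero_runs_zero[OF T] by blast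
    qed
  qed
  have "T \<subseteq> {Min S..b}" using b less by (metis atLeastatMost_subset_iff less_imp_le order_refl)
  then have "T = {Min S..b}" using zero b less by (intro zero_runs_maximal[OF T]) auto
  then have "Min S \<in> T" using b less by simp
  then show False using b less by (metis atLeastAtMost_iff linorder_not_less)
qed

text \<open>The first columns of the zero runs are classified by the 1-entry of P that the new
  1-entry plays. Each class is a family, so summing the bounds over the 1-entries of P gives a bound
  that is independent of M.\<close>

lemma row_bounding_if_bounded_at:
  assumes "\<And>p q. (p, q) \<in> ones k l P \<Longrightarrow> bounded_at k l P p q"
  shows "row_bounding k l P"
proof -
  let ?S = "ones k l P"
  have fin: "finite ?S" by (rule finite_subset[of _ "{1..k} \<times> {1..l}"]) (auto simp: ones_def)
  have "\<forall>x\<in>?S. \<exists>N. \<forall>m n M i E r c. family k l P m n M (fst x) (snd x) i E r c \<longrightarrow> card E \<le> N"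
    using assms unfolding bounded_at_def by force
  then obtain N where N: "\<And>x m n M i E r c. x \<in> ?S \<Longrightarrow>
      family k l P m n M (fst x) (snd x) i E r c \<Longrightarrow> card E \<le> N x"
    by metis
  have "row_complexity n M i \<le> sum N ?S" if crit: "critical_Av k l P m n M" and i: "i \<in> {1..m}" for m n M i
  proof -
    define E where "E = Min ` zero_runs n M i"
    have E: "E \<subseteq> {1..n}" and zero: "\<not> M i e" if "e \<in> E" for e
      using zero_runs_zero zero_runs_Min_in that unfolding E_def by blast+
    define good where "good e x r c \<longleftrightarrow> x \<in> ?S \<and> grid k m r \<and> grid l n c \<and>
        i \<in> {r (fst x - 1)<..r (fst x)} \<and> e \<in> {c (snd x - 1)<..c (snd x)} \<and>
        (\<forall>(a, b)\<in>?S. (a, b) \<noteq> x \<longrightarrow> hit M r c a b)" for e x r c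
    have "\<forall>e\<in>E. \<exists>x r c. good e x r c"
    proof
      fix e assume e: "e \<in> E"
      then have "e \<in> {1..n}" "\<not> M i e" using E zero by blast+
      from critical_gridding[OF crit i this] obtain p q r c where
        "(p, q) \<in> ?S" "grid k m r" "grid l n c" "i \<in> {r (p - 1)<..r p}" "e \<in> {c (q - 1)<..c q}"
        "\<forall>(a, b)\<in>?S. (a, b) \<noteq> (p, q) \<longrightarrow> hit M r c a b"
        by blast
      then show "\<exists>x r c. good e x r c"
        by (intro exI[of _ "(p, q)"] exI[of _ r] exI[of _ c]) (simp add: good_def)
    qed
    then obtain x r c where "\<And>e. e \<in> E \<Longrightarrow> good e (x e) (r e) (c e)" by metis
    note x = this[unfolded good_def]
    have no_minor: "\<not> interval_minor k l P m n M"
      using crit by (simp add: critical_Av_def avoids_def)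
    have card_y: "card {e\<in>E. x e = y} \<le> N y" if y: "y \<in> ?S" for y
    proof (rule N[OF y])
      show "family k l P m n M (fst y) (snd y) i {e\<in>E. x e = y} r c"
      proof
        show "{e\<in>E. x e = y} \<subseteq> {1..n}" using E by blast
        fix e e' assume "e \<in> {e\<in>E. x e = y}" "e' \<in> {e\<in>E. x e = y}" "e < e'"
        then show "\<exists>f>e. f < e' \<and> M i f" using zero_runs_separated unfolding E_def by blast
      qed (use no_minor y x in auto)
    qed
    have "E = (\<Union>y\<in>?S. {e\<in>E. x e = y})" using x by blast
    then have "card E \<le> (\<Sum>y\<in>?S. card {e\<in>E. x e = y})" using card_UN_le[OF fin] by metis
    also have "\<dots> \<le> sum N ?S" using card_y by (rule sum_mono)
    finally show ?thesis
      unfolding row_complexity_def E_def card_image[OF inj_on_Min_zero_runs] .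
  qed
  then show ?thesis unfolding row_bounding_def by blast
qed

section \<open>From the avoided patterns to monotone triples\<close>

lemma interval_minor_3I:
  fixes x y :: "nat \<Rightarrow> nat"
  assumes "1 \<le> x 1" "x 1 < x 2" "x 2 < x 3" "x 3 \<le> k" "1 \<le> y 1" "y 1 < y 2" "y 2 < y 3" "y 3 \<le> l"
    and PQ: "\<And>i j. (i, j) \<in> ones 3 3 Q \<Longrightarrow> P (x i) (y j)"
  shows "interval_minor 3 3 Q k l P"
proof -
  \<comment> \<open>Each block ends at its selected index, except the last one, which has to run on
    to N.\<close>
  define g where "g z N i = (if i = 0 then 0 else if i < 3 then z i else N)"
    for z :: "nat \<Rightarrow> nat" and N i :: nat
  have three: "i = 0 \<or> i = 1 \<or> i = 2" if "i < 3" for i :: nat using that by linarith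
  have grid: "grid 3 N (g z N)" if "1 \<le> z 1" "z 1 < z 2" "z 2 < z 3" "z 3 \<le> N" for z N
    by (rule gridI) (use that three in \<open>fastforce simp: g_def numeral_2_eq_2 numeral_3_eq_3\<close>)+
  have window: "z i \<in> {g z N (i - 1)<..g z N i}"
    if "1 \<le> z 1" "z 1 < z 2" "z 2 < z 3" "z 3 \<le> N" "1 \<le> i" "i \<le> 3" for z N i
  proof -
    have "i = 1 \<or> i = 2 \<or> i = 3" using that(5,6) by linarith
    then consider "i = 1" | "i = 2" | "i = 3" by blast
    then show ?thesis using that by cases (auto simp: g_def)
  qed
  have "hit P (g x k) (g y l) i j" if ij: "(i, j) \<in> ones 3 3 Q" for i j
    using PQ[OF ij] window[of x k i] window[of y l j] assms(1-8) onesD[OF ij] unfolding hit_def by blast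
  then show ?thesis using grid[of x k] grid[of y l] assms unfolding interval_minor_iff by blast
qed

text \<open>Read by columns, the row numbers in the supports of Q1, Q2, Q3, Q4 are 2 1 3, 3 1 2, 1 3
  2, 2 3 1: exactly the non-monotone permutations of three elements, one per case.\<close>

lemma monotone_triples_if_avoids:
  assumes Q: "avoids 3 3 Q1 k l P" "avoids 3 3 Q2 k l P" "avoids 3 3 Q3 k l P" "avoids 3 3 Q4 k l P"
  shows "monotone_triples (ones k l P)"
  unfolding monotone_triples_def
proof (intro allI impI, elim conjE)
  fix a1 b1 a2 b2 a3 b3
  assume h: "(a1, b1) \<in> ones k l P" "(a2, b2) \<in> ones k l P" "(a3, b3) \<in> ones k l P"
    and b: "b1 < b2" "b2 < b3" and a: "a1 \<noteq> a2" "a2 \<noteq> a3" "a1 \<noteq> a3"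
  let ?sel = "\<lambda>x1 x2 x3 i :: nat. if i = 1 then x1 else if i = 2 then x2 else x3 :: nat"
  note h' = onesD[OF h(1)] onesD[OF h(2)] onesD[OF h(3)]
  show "a1 < a2 \<and> a2 < a3 \<or> a3 < a2 \<and> a2 < a1"
  proof (rule ccontr)
    assume "\<not> ?thesis"
    then consider "a2 < a1" "a1 < a3" | "a2 < a3" "a3 < a1" | "a1 < a3" "a3 < a2" | "a3 < a1" "a1 < a2"
      using a by linarith
    then show False
    proof cases
      case 1
      have "interval_minor 3 3 Q1 k l P"
        by (rule interval_minor_3I[of "?sel a2 a1 a3" _ "?sel b1 b2 b3"])
          (use 1 b h' in \<open>auto simp: ones_def Q1_def\<close>)
      then show False using Q(1) by (simp add: avoids_def)
    next
      case 2
      have "interval_minor 3 3 Q2 k l P"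
        by (rule interval_minor_3I[of "?sel a2 a3 a1" _ "?sel b1 b2 b3"])
          (use 2 b h' in \<open>auto simp: ones_def Q2_def\<close>)
      then show False using Q(2) by (simp add: avoids_def)
    next
      case 3
      have "interval_minor 3 3 Q3 k l P"
        by (rule interval_minor_3I[of "?sel a1 a3 a2" _ "?sel b1 b2 b3"])
          (use 3 b h' in \<open>auto simp: ones_def Q3_def\<close>)
      then show False using Q(3) by (simp add: avoids_def)
    next
      case 4
      have "interval_minor 3 3 Q4 k l P"
        by (rule interval_minor_3I[of "?sel a3 a1 a2" _ "?sel b1 b2 b3"])
          (use 4 b h' in \<open>auto simp: ones_def Q4_def\<close>)
      then show False using Q(4) by (simp add: avoids_def)
    qed
  qed
qed

theorem theorem3p18:
  fixes k l :: nat and P :: "nat \<Rightarrow> nat \<Rightarrow> bool"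
  assumes "avoids 3 3 Q1 k l P" and "avoids 3 3 Q2 k l P"
      and "avoids 3 3 Q3 k l P" and "avoids 3 3 Q4 k l P"
  shows "row_bounding k l P"
  using row_bounding_if_bounded_at bounded_at_monotone monotone_triples_if_avoids[OF assms]
  by blast

end
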